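(* Let $\mathbf g,\mathbf h,\mathbf i,\mathbf j,\mathbf k,\mathbf l,\mathbf m,\mathbf q,\mathbf r\in E$ with $(\mathbf g,\mathbf h,\mathbf i),(\mathbf j,\mathbf k,\mathbf l),(\mathbf m,\mathbf q,\mathbf r)\in\mathbb{P}$ and $p\nmid k_{\mathbf h}k_{\mathbf k}k_{\mathbf q}$. If $\mathbf i=\mathbf j$ and $(S(\mathbf h)\cap S(\mathbf i)\cap S(\mathbf l))^\circ\subseteq S(\mathbf k)$, then $(\mathbf g,[\mathbf g,\mathbf h,\mathbf i,\mathbf k,\mathbf l],\mathbf l)\in\mathbb{P}$ and $p\nmid k_{[\mathbf g,\mathbf h,\mathbf i,\mathbf k,\mathbf l]}$. Moreover, the coefficient of $D_{\mathbf m,\mathbf q,\mathbf r}+\mathrm{Rad}(\mathbb{T})$ in the expansion of $(D_{\mathbf g,\mathbf h,\mathbf i}+\mathrm{Rad}(\mathbb{T}))(D_{\mathbf j,\mathbf k,\mathbf l}+\mathrm{Rad}(\mathbb{T}))$ with respect to the basis $\{D_{\mathbf a,\mathbf b,\mathbf c}+\mathrm{Rad}(\mathbb{T}):(\mathbf a,\mathbf b,\mathbf c)\in\mathbb{P},\ p\nmid k_{\mathbf b}\}$ of $\mathbb{T}/\mathrm{Rad}(\mathbb{T})$ equals $\delta_{\mathbf i,\mathbf j}\delta_{\mathbf m,\mathbf g}\delta_{\mathbf q,[\mathbf g,\mathbf h,\mathbf i,\mathbf k,\mathbf l]}\delta_{\mathbf r,\mathbf l}\,\delta_{(S(\mathbf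 g)\cap S(\mathbf i))^\circ\setminus S(\mathbf h),\ (S(\mathbf i)\cap S(\mathbf l))^\circ\setminus S(\mathbf k)}$.
   Context: Let $\mathbb{F}$ be a field of characteristic $p\ge 0$; $\overline m$ is the image in $\mathbb{F}$ of an integer $m$, "$p\mid m$" (for $m>0$) means $\overline m=0$, and $\delta$ is the Kronecker delta with values in $\mathbb{F}$. Let $n\ge 1$ and let $U_1,\dots,U_n$ be finite sets with $|U_h|\ge 2$. Put $X=U_1\times\cdots\times U_n$ and $E=\{0,1\}^n$. For $\mathbf g\in E$ let $S(\mathbf g)=\{a:\mathbf g_a=1\}$; $\mathbf g\preceq\mathbf h$ iff $S(\mathbf g)\subseteq S(\mathbf h)$; $\mathbf g\cap\mathbf h$ has support $S(\mathbf g)\cap S(\mathbf h)$. For $V\subseteq\{1,\dots,n\}$ let $V^\circ=\{a\in V:|U_a|>2\}$. Let $R_{\mathbf g}=\{(\mathbf y,\mathbf z)\in X\times X:\ \mathbf y_a\neq\mathbf z_a\iff\mathbf g_a=1\}$ and $k_{\mathbf g}=\prod_{a\in S(\mathbf g)}(|U_a|-1)$ ($k_{\mathbf 0}=1$). Let $A_{\mathbf g}\in\mathrm{M}_X(\mathbb{F})$ be the $\{0,1\}$ adjacency matrix of $R_{\mathbf g}$. Fix $\mathbf x\in X$ and let $E^*_{\mathbf g}$ be the diagonal matrix with $(\mathbf y,\mathbf y)$-entry $1$ iff $(\mathbf x,\mathbf y)\in R_{\mathbf g}$, else $0$. $\mathbb{T}$ is the $\mathbb{F}$-subalgebra of $\mathrm{M}_X(\mathbb{F})$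 generated by all $A_{\mathbf g},E^*_{\mathbf g}$, with Jacobson radical $\mathrm{Rad}(\mathbb{T})$. Let $\mathbb{P}$ be the set of $(\mathbf a,\mathbf b,\mathbf c)\in E^3$ with $S(\mathbf a)\triangle S(\mathbf c)\subseteq S(\mathbf b)\subseteq(S(\mathbf a)\triangle S(\mathbf c))\cup(S(\mathbf a)\cap S(\mathbf c))^\circ$. For $(\mathbf g,\mathbf h,\mathbf i)\in\mathbb{P}$ let $B_{\mathbf g,\mathbf h,\mathbf i}=\sum_{\mathbf j}E^*_{\mathbf g}A_{\mathbf j}E^*_{\mathbf i}$ over $\mathbf j\in E$ with $S(\mathbf g)\triangle S(\mathbf i)\subseteq S(\mathbf j)\subseteq S(\mathbf h)$. For $\mathbf g,\mathbf h,\mathbf i,\mathbf j,\mathbf k\in E$, $[\mathbf g,\mathbf h,\mathbf i,\mathbf j,\mathbf k]$ is the element of $E$ with support $(S(\mathbf g)\triangle S(\mathbf k))\cup((S(\mathbf g)\cap S(\mathbf k))^\circ\setminus S(\mathbf i))\cup((S(\mathbf h)\cup S(\mathbf j))\cap(S(\mathbf g)\cap S(\mathbf i)\cap S(\mathbf k))^\circ)$. For $\mathbf g,\mathbf i\in E$ let $\mathbf g\mathbf i$ have support $(S(\mathbf g)\triangle S(\mathbf i))\cup(S(\mathbf g)\cap S(\mathbf i))^\circ$. For $\mathbf h\preceq\mathbf f$ let $n_{\mathbf f,\mathbf h}=|\{a\in S(\mathbf f)\setminus S(\mathbf h):p\nmid|U_a|-1\}|$ and $\mathbb{U}_{\mathbf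 f,\mathbf h,k}=\{\mathbf a\in E:\mathbf h\preceq\mathbf a\preceq\mathbf f,\ p\nmid k_{\mathbf a},\ |S(\mathbf a)\setminus S(\mathbf h)|=k\}$. For $(\mathbf g,\mathbf h,\mathbf i)\in\mathbb{P}$ with $p\nmid k_{\mathbf h}$, $D_{\mathbf g,\mathbf h,\mathbf i}=\sum_{k=0}^{n_{\mathbf g\mathbf i,\mathbf h}}\sum_{\mathbf l\in\mathbb{U}_{\mathbf g\mathbf i,\mathbf h,k}}(-1)^k\overline{k_{\mathbf i\cap\mathbf l}}^{\,-1}B_{\mathbf g,\mathbf l,\mathbf i}$. The cosets $D_{\mathbf a,\mathbf b,\mathbf c}+\mathrm{Rad}(\mathbb{T})$, $(\mathbf a,\mathbf b,\mathbf c)\in\mathbb{P}$, $p\nmid k_{\mathbf b}$, form an $\mathbb{F}$-basis of $\mathbb{T}/\mathrm{Rad}(\mathbb{T})$. *)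

theory Defs
  imports
    "HOL-Library.FuncSet"
    "HOL-Algebra.QuotRing"
    "HOL-Algebra.Module"
    "HOL-Algebra.Subrings"
begin

section \<open>Algebras, Jacobson radical, coordinates\<close>

text \<open>
  An algebra over the field \<open>'f\<close> is represented by a record of type \<open>('f, 'b) module\<close>, which
  carries ring operations and a scalar multiplication.
\<close>

text \<open>The matrix algebra \<open>M\<^sub>X(F)\<close>: its elements are the functions vanishing off \<open>X \<times> X\<close>.\<close>

definition mat_alg :: "'x set \<Rightarrow> ('f::field, 'x \<Rightarrow> 'x \<Rightarrow> 'f) module" where
  "mat_alg X =
    \<lparr>carrier = {M. \<forall>y z. y \<notin> X \<or> z \<notin> X \<longrightarrow> M y z = 0},
     mult = (\<lambda>M N y z. \<Sum>w\<in>X. M y w * N w z),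
     one = (\<lambda>y z. if y \<in> X \<and> y = z then 1 else 0),
     zero = (\<lambda>y z. 0),
     add = (\<lambda>M N y z. M y z + N y z),
     smult = (\<lambda>c M y z. c * M y z)\<rparr>"

definition is_subalgebra :: "'b set \<Rightarrow> ('f, 'b) module \<Rightarrow> bool" where
  "is_subalgebra S A \<longleftrightarrow> subring S A \<and> (\<forall>c. \<forall>x\<in>S. c \<odot>\<^bsub>A\<^esub> x \<in> S)"

definition generated_subalgebra :: "('f, 'b) module \<Rightarrow> 'b set \<Rightarrow> ('f, 'b) module" where
  "generated_subalgebra A G = A\<lparr>carrier := \<Inter>{S. is_subalgebra S A \<and> G \<subseteq> S}\<rparr>"

definition left_ideal :: "'b set \<Rightarrow> ('b, 'm) ring_scheme \<Rightarrow> bool" where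
  "left_ideal I R \<longleftrightarrow> additive_subgroup I R \<and> (\<forall>a\<in>carrier R. \<forall>x\<in>I. a \<otimes>\<^bsub>R\<^esub> x \<in> I)"

definition maximal_left_ideal :: "'b set \<Rightarrow> ('b, 'm) ring_scheme \<Rightarrow> bool" where
  "maximal_left_ideal I R \<longleftrightarrow>
    left_ideal I R \<and> I \<noteq> carrier R \<and>
    (\<forall>J. left_ideal J R \<and> I \<subseteq> J \<longrightarrow> J = I \<or> J = carrier R)"

definition jacobson_radical :: "('b, 'm) ring_scheme \<Rightarrow> 'b set" where
  "jacobson_radical R = carrier R \<inter> \<Inter>{I. maximal_left_ideal I R}"

text \<open>The factor ring together with the induced scalar multiplication \<open>c (x + I) = c x + I\<close>.\<close>

definition quot_alg :: "('f, 'b) module \<Rightarrow> 'b set \<Rightarrow> ('f, 'b set) module" where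
  "quot_alg A I = ring.extend (A Quot I)
     (module.fields (\<lambda>c C. \<Union>x\<in>C. I +>\<^bsub>A\<^esub> (c \<odot>\<^bsub>A\<^esub> x)))"

text \<open>
  \<open>basis_coeff V B v b\<close> is the coefficient of \<open>b\<close> in the expansion of \<open>v\<close> with respect to the
  finite basis \<open>B\<close> of \<open>V\<close>. Coefficient functions are extensional on \<open>B\<close>, so that the expansion
  with respect to a basis is unique as a function.
\<close>

definition basis_coeff :: "('f, 'b) module \<Rightarrow> 'b set \<Rightarrow> 'b \<Rightarrow> 'b \<Rightarrow> 'f" where
  "basis_coeff V B v b =
    (THE c. c \<in> B \<rightarrow>\<^sub>E UNIV \<and> v = (\<Oplus>\<^bsub>V\<^esub>u\<in>B. c u \<odot>\<^bsub>V\<^esub> u)) b"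


section \<open>The factorial scheme and its Terwilliger algebra\<close>

text \<open>
  Throughout, \<open>U 1, \<dots>, U n\<close> are the factors; tuples are extensional functions on \<open>{1..n}\<close>.
\<close>

definition pts :: "nat \<Rightarrow> (nat \<Rightarrow> 'u set) \<Rightarrow> (nat \<Rightarrow> 'u) set" where
  "pts n U = (\<Pi>\<^sub>E a\<in>{1..n}. U a)"

definition EE :: "nat \<Rightarrow> (nat \<Rightarrow> nat) set" where
  "EE n = (\<Pi>\<^sub>E a\<in>{1..n}. {0, 1})"

definition supp :: "nat \<Rightarrow> (nat \<Rightarrow> nat) \<Rightarrow> nat set" where
  "supp n g = {a\<in>{1..n}. g a = 1}"

definition with_supp :: "nat \<Rightarrow> nat set \<Rightarrow> nat \<Rightarrow> nat" where
  "with_supp n V = (\<lambda>a\<in>{1..n}. if a \<in> V then 1 else 0)"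

definition preceq :: "nat \<Rightarrow> (nat \<Rightarrow> nat) \<Rightarrow> (nat \<Rightarrow> nat) \<Rightarrow> bool" where
  "preceq n g h \<longleftrightarrow> supp n g \<subseteq> supp n h"

definition meet :: "nat \<Rightarrow> (nat \<Rightarrow> nat) \<Rightarrow> (nat \<Rightarrow> nat) \<Rightarrow> nat \<Rightarrow> nat" where
  "meet n g h = with_supp n (supp n g \<inter> supp n h)"

text \<open>\<open>circ U V\<close> is \<open>V\<^sup>\<circ>\<close>.\<close>

definition circ :: "(nat \<Rightarrow> 'u set) \<Rightarrow> nat set \<Rightarrow> nat set" where
  "circ U V = {a\<in>V. card (U a) > 2}"

definition rel :: "nat \<Rightarrow> (nat \<Rightarrow> 'u set) \<Rightarrow> (nat \<Rightarrow> nat) \<Rightarrow> ((nat \<Rightarrow> 'u) \<times> (nat \<Rightarrow> 'u)) set" where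
  "rel n U g = {(y, z). y \<in> pts n U \<and> z \<in> pts n U \<and> (\<forall>a\<in>{1..n}. y a \<noteq> z a \<longleftrightarrow> g a = 1)}"

definition valency :: "nat \<Rightarrow> (nat \<Rightarrow> 'u set) \<Rightarrow> (nat \<Rightarrow> nat) \<Rightarrow> nat" where
  "valency n U g = (\<Prod>a\<in>supp n g. card (U a) - 1)"

definition adj :: "nat \<Rightarrow> (nat \<Rightarrow> 'u set) \<Rightarrow> (nat \<Rightarrow> nat)
    \<Rightarrow> (nat \<Rightarrow> 'u) \<Rightarrow> (nat \<Rightarrow> 'u) \<Rightarrow> 'f::field" where
  "adj n U g = (\<lambda>y z. if (y, z) \<in> rel n U g then 1 else 0)"

definition dual_idem :: "nat \<Rightarrow> (nat \<Rightarrow> 'u set) \<Rightarrow> (nat \<Rightarrow> 'u) \<Rightarrow> (nat \<Rightarrow> nat)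
    \<Rightarrow> (nat \<Rightarrow> 'u) \<Rightarrow> (nat \<Rightarrow> 'u) \<Rightarrow> 'f::field" where
  "dual_idem n U x g = (\<lambda>y z. if y = z \<and> (x, y) \<in> rel n U g then 1 else 0)"

definition terwilliger :: "nat \<Rightarrow> (nat \<Rightarrow> 'u set) \<Rightarrow> (nat \<Rightarrow> 'u)
    \<Rightarrow> ('f::field, (nat \<Rightarrow> 'u) \<Rightarrow> (nat \<Rightarrow> 'u) \<Rightarrow> 'f) module" where
  "terwilliger n U x =
    generated_subalgebra (mat_alg (pts n U)) (adj n U ` EE n \<union> dual_idem n U x ` EE n)"

definition PP :: "nat \<Rightarrow> (nat \<Rightarrow> 'u set) \<Rightarrow> ((nat \<Rightarrow> nat) \<times> (nat \<Rightarrow> nat) \<times> (nat \<Rightarrow> nat)) set" where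
  "PP n U = {(a, b, c). a \<in> EE n \<and> b \<in> EE n \<and> c \<in> EE n \<and>
     sym_diff (supp n a) (supp n c) \<subseteq> supp n b \<and>
     supp n b \<subseteq> sym_diff (supp n a) (supp n c) \<union> circ U (supp n a \<inter> supp n c)}"

definition BB :: "nat \<Rightarrow> (nat \<Rightarrow> 'u set) \<Rightarrow> (nat \<Rightarrow> 'u) \<Rightarrow> (nat \<Rightarrow> nat) \<Rightarrow> (nat \<Rightarrow> nat) \<Rightarrow> (nat \<Rightarrow> nat)
    \<Rightarrow> (nat \<Rightarrow> 'u) \<Rightarrow> (nat \<Rightarrow> 'u) \<Rightarrow> 'f::field" where
  "BB n U x g h i = (\<lambda>y z.
     \<Sum>j\<in>{j\<in>EE n. sym_diff (supp n g) (supp n i) \<subseteq> supp n j \<and> supp n j \<subseteq> supp n h}.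
       (dual_idem n U x g \<otimes>\<^bsub>mat_alg (pts n U)\<^esub> adj n U j \<otimes>\<^bsub>mat_alg (pts n U)\<^esub> dual_idem n U x i) y z)"

text \<open>\<open>bracket n U g h i j k\<close> is \<open>[g, h, i, j, k]\<close>; \<open>cprod n U g i\<close> is \<open>gi\<close>.\<close>

definition bracket :: "nat \<Rightarrow> (nat \<Rightarrow> 'u set) \<Rightarrow> (nat \<Rightarrow> nat) \<Rightarrow> (nat \<Rightarrow> nat) \<Rightarrow> (nat \<Rightarrow> nat)
    \<Rightarrow> (nat \<Rightarrow> nat) \<Rightarrow> (nat \<Rightarrow> nat) \<Rightarrow> nat \<Rightarrow> nat" where
  "bracket n U g h i j k = with_supp n
     (sym_diff (supp n g) (supp n k) \<union>
      (circ U (supp n g \<inter> supp n k) - supp n i) \<union>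
      ((supp n h \<union> supp n j) \<inter> circ U (supp n g \<inter> supp n i \<inter> supp n k)))"

definition cprod :: "nat \<Rightarrow> (nat \<Rightarrow> 'u set) \<Rightarrow> (nat \<Rightarrow> nat) \<Rightarrow> (nat \<Rightarrow> nat) \<Rightarrow> nat \<Rightarrow> nat" where
  "cprod n U g i = with_supp n
     (sym_diff (supp n g) (supp n i) \<union> circ U (supp n g \<inter> supp n i))"

text \<open>
  For \<open>m > 0\<close> and \<open>p = CHAR('f)\<close>, \<open>p dvd m\<close> holds iff \<open>of_nat m = (0::'f)\<close>; this includes \<open>p = 0\<close>,
  since \<open>0 dvd m\<close> only for \<open>m = 0\<close>.
\<close>

definition ndeg :: "nat \<Rightarrow> nat \<Rightarrow> (nat \<Rightarrow> 'u set) \<Rightarrow> (nat \<Rightarrow> nat) \<Rightarrow> (nat \<Rightarrow> nat) \<Rightarrow> nat" where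
  "ndeg p n U f h = card {a \<in> supp n f - supp n h. \<not> p dvd (card (U a) - 1)}"

definition UU :: "nat \<Rightarrow> nat \<Rightarrow> (nat \<Rightarrow> 'u set) \<Rightarrow> (nat \<Rightarrow> nat) \<Rightarrow> (nat \<Rightarrow> nat) \<Rightarrow> nat
    \<Rightarrow> (nat \<Rightarrow> nat) set" where
  "UU p n U f h k = {a \<in> EE n. preceq n h a \<and> preceq n a f \<and> \<not> p dvd valency n U a \<and>
     card (supp n a - supp n h) = k}"

definition DD :: "nat \<Rightarrow> (nat \<Rightarrow> 'u set) \<Rightarrow> (nat \<Rightarrow> 'u) \<Rightarrow> (nat \<Rightarrow> nat) \<Rightarrow> (nat \<Rightarrow> nat) \<Rightarrow> (nat \<Rightarrow> nat)
    \<Rightarrow> (nat \<Rightarrow> 'u) \<Rightarrow> (nat \<Rightarrow> 'u) \<Rightarrow> 'f::field" where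
  "DD n U x g h i = (\<lambda>y z.
     \<Sum>k = 0..ndeg CHAR('f) n U (cprod n U g i) h.
       \<Sum>l\<in>UU CHAR('f) n U (cprod n U g i) h k.
         (- 1) ^ k * inverse (of_nat (valency n U (meet n i l))) * BB n U x g l i y z)"

definition TRad :: "nat \<Rightarrow> (nat \<Rightarrow> 'u set) \<Rightarrow> (nat \<Rightarrow> 'u)
    \<Rightarrow> ('f::field, ((nat \<Rightarrow> 'u) \<Rightarrow> (nat \<Rightarrow> 'u) \<Rightarrow> 'f) set) module" where
  "TRad n U x = quot_alg (terwilliger n U x) (jacobson_radical (terwilliger n U x))"

definition Dcoset :: "nat \<Rightarrow> (nat \<Rightarrow> 'u set) \<Rightarrow> (nat \<Rightarrow> 'u) \<Rightarrow> (nat \<Rightarrow> nat) \<Rightarrow> (nat \<Rightarrow> nat) \<Rightarrow> (nat \<Rightarrow> nat)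
    \<Rightarrow> ((nat \<Rightarrow> 'u) \<Rightarrow> (nat \<Rightarrow> 'u) \<Rightarrow> 'f::field) set" where
  "Dcoset n U x g h i =
     jacobson_radical (terwilliger n U x) +>\<^bsub>terwilliger n U x\<^esub> DD n U x g h i"

definition Dbasis :: "nat \<Rightarrow> (nat \<Rightarrow> 'u set) \<Rightarrow> (nat \<Rightarrow> 'u)
    \<Rightarrow> ((nat \<Rightarrow> 'u) \<Rightarrow> (nat \<Rightarrow> 'u) \<Rightarrow> 'f::field) set set" where
  "Dbasis n U x =
     {Dcoset n U x a b c | a b c. (a, b, c) \<in> PP n U \<and> \<not> CHAR('f) dvd valency n U b}"

end

theory Submission
  imports Defs
begin

text \<open>
  The entry of \<open>D\<^sub>g\<^sub>,\<^sub>h\<^sub>,\<^sub>i\<close> at \<open>(y, z)\<close> is a product of factors depending on one coordinate each, since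
  the alternating sum over \<open>l\<close> is the expansion of a product over the coordinates. Hence products of
  the \<open>D\<close>'s can be computed coordinatewise, in the Terwilliger algebra of a single factor with point
  set \<open>V\<close>, where \<open>D\<close> runs through \<open>I\<close>, \<open>I - J/(|V| - 1)\<close> and normalised all-one blocks \<open>J\<close>. The
  outcome is exact: the product is \<open>0\<close> or the \<open>D\<close> indexed by the bracket, without passing to the
  quotient by the radical. In particular the \<open>D\<close>'s multiply like the matrix units of a direct sum of
  full matrix algebras, and since the radical contains no nonzero idempotent they stay linearly
  independent modulo the radical, so the coefficients can be read off.
\<close>

section \<open>The Jacobson radical\<close>

text \<open>Closure under negatives follows from absorption, since
  \<open>\<ominus> u = \<ominus> \<one> \<otimes> u\<close>.\<close>

lemma (in ring) left_idealI:
  assumes "I \<subseteq> carrier R" "\<zero> \<in> I"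
    and "\<And>u v. u \<in> I \<Longrightarrow> v \<in> I \<Longrightarrow> u \<oplus> v \<in> I"
    and "\<And>a u. a \<in> carrier R \<Longrightarrow> u \<in> I \<Longrightarrow> a \<otimes> u \<in> I"
  shows "left_ideal I R"
proof -
  have "\<ominus> u \<in> I" if "u \<in> I" for u
  proof -
    have "\<ominus> \<one> \<otimes> u \<in> I" using assms(4)[of "\<ominus> \<one>" u] that by simp
    then show ?thesis using that assms(1) by (simp add: l_minus subset_iff)
  qed
  then have "subgroup I (add_monoid R)"
    using assms by (intro add.subgroupI) auto
  then show ?thesis
    using assms(4) by (simp add: left_ideal_def additive_subgroup_def)
qed

lemma left_idealD:
  assumes "left_ideal I R"
  shows "I \<subseteq> carrier R" "\<zero>\<^bsub>R\<^esub> \<in> I"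
    and "\<And>u v. u \<in> I \<Longrightarrow> v \<in> I \<Longrightarrow> u \<oplus>\<^bsub>R\<^esub> v \<in> I"
    and "\<And>a u. a \<in> carrier R \<Longrightarrow> u \<in> I \<Longrightarrow> a \<otimes>\<^bsub>R\<^esub> u \<in> I"
  using assms
  by (auto simp: left_ideal_def additive_subgroup.a_subset[THEN subsetD]
      additive_subgroup.zero_closed additive_subgroup.a_closed)

lemma (in ring) left_ideal_one_eq_carrier:
  assumes "left_ideal I R" "\<one> \<in> I"
  shows "I = carrier R"
proof
  show "carrier R \<subseteq> I"
  proof
    fix a assume "a \<in> carrier R"
    then show "a \<in> I" using left_idealD(4)[OF assms(1) _ assms(2), of a] by simp
  qed
qed (rule left_idealD(1)[OF assms(1)])

text \<open>This is \<open>I + R v\<close>. For maximal \<open>I\<close> and \<open>v\<close>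
  outside it the sum is the whole ring, which yields equations
  \<open>a = u \<oplus> s \<otimes> v\<close>.\<close>

lemma (in ring) left_ideal_add_principal:
  assumes I: "left_ideal I R" and v: "v \<in> carrier R"
  shows "left_ideal {u \<oplus> s \<otimes> v | u s. u \<in> I \<and> s \<in> carrier R} R" (is "left_ideal ?K R")
    and "I \<subseteq> {u \<oplus> s \<otimes> v | u s. u \<in> I \<and> s \<in> carrier R}"
    and "v \<in> {u \<oplus> s \<otimes> v | u s. u \<in> I \<and> s \<in> carrier R}"
proof -
  note D = left_idealD[OF I]
  have c: "u \<in> carrier R" if "u \<in> I" for u using D(1) that by blast
  show sub: "I \<subseteq> ?K"
  proof
    fix u assume u: "u \<in> I"
    then have "u = u \<oplus> \<zero> \<otimes> v" using v c by simp
    then show "u \<in> ?K" using u zero_closed by blast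
  qed
  have "v = \<zero> \<oplus> \<one> \<otimes> v" using v by simp
  then show "v \<in> ?K" using D(2) one_closed by blast
  show "left_ideal ?K R"
  proof (rule left_idealI)
    show "?K \<subseteq> carrier R" using c v by auto
    show "\<zero> \<in> ?K" using sub D(2) by blast
  next
    fix p q assume "p \<in> ?K" "q \<in> ?K"
    then obtain u s u' s' where *: "p = u \<oplus> s \<otimes> v" "q = u' \<oplus> s' \<otimes> v"
      "u \<in> I" "u' \<in> I" "s \<in> carrier R" "s' \<in> carrier R" by blast
    have "p \<oplus> q = (u \<oplus> u') \<oplus> (s \<oplus> s') \<otimes> v"
      using * c v by (simp add: l_distr a_ac)
    moreover have "u \<oplus> u' \<in> I" "s \<oplus> s' \<in> carrier R" using * D(3) by auto
    ultimately show "p \<oplus> q \<in> ?K" by blast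
  next
    fix a p assume a: "a \<in> carrier R" and "p \<in> ?K"
    then obtain u s where *: "p = u \<oplus> s \<otimes> v" "u \<in> I" "s \<in> carrier R" by blast
    have "a \<otimes> p = a \<otimes> u \<oplus> (a \<otimes> s) \<otimes> v"
      using * a c v by (simp add: r_distr m_assoc)
    moreover have "a \<otimes> u \<in> I" "a \<otimes> s \<in> carrier R" using * a D(4) by auto
    ultimately show "a \<otimes> p \<in> ?K" by blast
  qed
qed

text \<open>Zorn's lemma on left ideals avoiding \<open>\<one>\<close>. For left ideals this amounts
  to being proper, and it visibly passes to unions of chains.\<close>

lemma (in ring) maximal_left_ideal_exists:
  assumes I: "left_ideal I R" and "\<one> \<notin> I"
  obtains M where "maximal_left_ideal M R" "I \<subseteq> M"
proof -
  define A where "A = {J. left_ideal J R \<and> I \<subseteq> J \<and> \<one> \<notin> J}"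
  have "\<exists>M\<in>A. \<forall>X\<in>A. M \<subseteq> X \<longrightarrow> X = M"
  proof (rule subset_Zorn_nonempty)
    show "A \<noteq> {}" using assms by (auto simp: A_def)
  next
    fix C assume C: "C \<noteq> {}" "subset.chain A C"
    then have CA: "C \<subseteq> A" and ch: "\<And>X Y. X \<in> C \<Longrightarrow> Y \<in> C \<Longrightarrow> X \<subseteq> Y \<or> Y \<subseteq> X"
      by (auto simp: subset_chain_def)
    have L: "left_ideal X R" if "X \<in> C" for X using that CA by (auto simp: A_def)
    obtain X0 where X0: "X0 \<in> C" using C(1) by blast
    have "left_ideal (\<Union>C) R"
    proof (rule left_idealI)
      show "\<Union>C \<subseteq> carrier R" using left_idealD(1)[OF L] by blast
      show "\<zero> \<in> \<Union>C" using left_idealD(2)[OF L[OF X0]] X0 by blast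
    next
      fix u v assume "u \<in> \<Union>C" "v \<in> \<Union>C"
      then obtain X Y where "X \<in> C" "Y \<in> C" "u \<in> X" "v \<in> Y" by blast
      then obtain Z where "Z \<in> C" "u \<in> Z" "v \<in> Z" using ch by blast
      then show "u \<oplus> v \<in> \<Union>C" using left_idealD(3)[OF L] by blast
    next
      fix a u assume "a \<in> carrier R" "u \<in> \<Union>C"
      then show "a \<otimes> u \<in> \<Union>C" using left_idealD(4)[OF L] by blast
    qed
    moreover have "I \<subseteq> \<Union>C" "\<one> \<notin> \<Union>C" using X0 CA by (auto simp: A_def)
    ultimately show "\<Union>C \<in> A" by (simp add: A_def)
  qed
  then obtain M where M: "M \<in> A" and max: "\<And>X. X \<in> A \<Longrightarrow> M \<subseteq> X \<Longrightarrow> X = M" by blast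
  have "J = M \<or> J = carrier R" if "left_ideal J R" "M \<subseteq> J" for J
    using that M max left_ideal_one_eq_carrier[of J] by (auto simp: A_def)
  then have "maximal_left_ideal M R"
    using M by (auto simp: maximal_left_ideal_def A_def)
  then show ?thesis using that M by (auto simp: A_def)
qed

text \<open>The set is the annihilator of the coset of \<open>a\<close> in the simple module
  \<open>R / M\<close>, and nonzero elements of simple modules have maximal annihilators.\<close>

lemma (in ring) maximal_left_ideal_transporter:
  assumes M: "maximal_left_ideal M R" and a: "a \<in> carrier R" "a \<notin> M"
  shows "maximal_left_ideal {t \<in> carrier R. t \<otimes> a \<in> M} R" (is "maximal_left_ideal ?N R")
proof -
  have LM: "left_ideal M R" using M by (simp add: maximal_left_ideal_def)
  note D = left_idealD[OF LM]
  have LN: "left_ideal ?N R"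
    using a(1) D by (intro left_idealI) (auto simp: l_distr m_assoc)
  have "\<one> \<notin> ?N" using a by simp
  then have ne: "?N \<noteq> carrier R" using one_closed by blast
  have "J = carrier R" if J: "left_ideal J R" and sub: "?N \<subseteq> J" and neq: "J \<noteq> ?N" for J
  proof -
    note DJ = left_idealD[OF J]
    obtain t where t: "t \<in> J" "t \<notin> ?N" using sub neq by blast
    have tc: "t \<in> carrier R" using t DJ(1) by blast
    then have ta: "t \<otimes> a \<in> carrier R" "t \<otimes> a \<notin> M" using t a by auto
    \<comment> \<open>Since \<open>t \<otimes> a\<close> lies outside \<open>M\<close>, the sum
      \<open>M + R t a\<close> is everything; writing \<open>a\<close> in this form puts
      \<open>\<one> \<ominus> s \<otimes> t\<close> into \<open>?N\<close>.\<close>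
    let ?K = "{u \<oplus> s \<otimes> (t \<otimes> a) | u s. u \<in> M \<and> s \<in> carrier R}"
    note K = left_ideal_add_principal[OF LM ta(1)]
    have "?K = carrier R"
      using M K ta(2) unfolding maximal_left_ideal_def by blast
    then have "a \<in> ?K" using a by simp
    then obtain u s where us: "a = u \<oplus> s \<otimes> (t \<otimes> a)" "u \<in> M" "s \<in> carrier R" by blast
    have uc: "u \<in> carrier R" using us(2) D(1) by blast
    have "(\<one> \<ominus> s \<otimes> t) \<otimes> a = a \<ominus> s \<otimes> (t \<otimes> a)"
      using us(3) tc a(1) by (simp add: minus_eq l_distr l_minus m_assoc)
    also have "\<dots> = u"
      using us uc ta(1) by (metis add.inv_solve_right' m_closed minus_eq a(1))
    finally have "\<one> \<ominus> s \<otimes> t \<in> ?N" using us tc by simp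
    then have "\<one> \<ominus> s \<otimes> t \<in> J" using sub by blast
    moreover have "s \<otimes> t \<in> J" using DJ(4) us(3) t by simp
    ultimately have "(\<one> \<ominus> s \<otimes> t) \<oplus> s \<otimes> t \<in> J" by (rule DJ(3))
    moreover have "(\<one> \<ominus> s \<otimes> t) \<oplus> s \<otimes> t = \<one>"
      using us(3) tc by (simp add: minus_eq a_assoc l_neg)
    ultimately show ?thesis using left_ideal_one_eq_carrier[OF J] by simp
  qed
  then show ?thesis using LN ne by (auto simp: maximal_left_ideal_def)
qed

text \<open>For absorption on the right, let \<open>a\<close> be outside \<open>M\<close>: an
  element \<open>v\<close> of the radical lies in every maximal left ideal, in particular in the
  transporter of \<open>a\<close> into \<open>M\<close>, so
  \<open>v \<otimes> a \<in> M\<close>.\<close>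

lemma (in ring) jacobson_radical_ideal: "ideal (jacobson_radical R) R"
proof -
  have L: "left_ideal M R" if "maximal_left_ideal M R" for M
    using that by (simp add: maximal_left_ideal_def)
  have LI: "left_ideal (jacobson_radical R) R"
    unfolding jacobson_radical_def
    by (rule left_idealI) (auto intro: left_idealD[OF L])
  have right: "v \<otimes> a \<in> jacobson_radical R" if v: "v \<in> jacobson_radical R" and a: "a \<in> carrier R"
    for v a
  proof -
    have vc: "v \<in> carrier R" using v by (simp add: jacobson_radical_def)
    have "v \<otimes> a \<in> M" if M: "maximal_left_ideal M R" for M
    proof (cases "a \<in> M")
      case True
      then show ?thesis using left_idealD(4)[OF L[OF M] vc] by simp
    next
      case False
      then have "v \<in> {t \<in> carrier R. t \<otimes> a \<in> M}"
        using v maximal_left_ideal_transporter[OF M a] unfolding jacobson_radical_def by blast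
      then show ?thesis by simp
    qed
    then show ?thesis using vc a by (simp add: jacobson_radical_def)
  qed
  have "additive_subgroup (jacobson_radical R) R"
    using LI by (simp add: left_ideal_def)
  then show ?thesis
    using LI right
    by (intro idealI) (auto simp: left_ideal_def additive_subgroup.a_subgroup ring_axioms)
qed

text \<open>The left annihilator of a nonzero idempotent \<open>e\<close> is proper and contains
  \<open>\<one> \<ominus> e\<close>. A maximal left ideal above it also contains \<open>e\<close>,
  hence \<open>\<one>\<close>.\<close>

lemma (in ring) idempotent_in_jacobson_radical:
  assumes e: "e \<in> jacobson_radical R" and idem: "e \<otimes> e = e"
  shows "e = \<zero>"
proof (rule ccontr)
  assume ne: "e \<noteq> \<zero>"
  have ec: "e \<in> carrier R" using e by (simp add: jacobson_radical_def)
  let ?I = "{t \<in> carrier R. t \<otimes> e = \<zero>}"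
  have "left_ideal ?I R"
    using ec by (intro left_idealI) (auto simp: l_distr m_assoc)
  moreover have "\<one> \<notin> ?I" using ec ne by simp
  ultimately obtain M where M: "maximal_left_ideal M R" "?I \<subseteq> M"
    by (rule maximal_left_ideal_exists)
  have LM: "left_ideal M R" using M(1) by (simp add: maximal_left_ideal_def)
  have "(\<one> \<ominus> e) \<otimes> e = \<zero>" using ec idem by (simp add: minus_eq l_distr l_minus r_neg)
  then have "\<one> \<ominus> e \<in> M" using M(2) ec by auto
  moreover have "e \<in> M" using e M(1) by (auto simp: jacobson_radical_def)
  ultimately have "(\<one> \<ominus> e) \<oplus> e \<in> M" by (rule left_idealD(3)[OF LM])
  then have "\<one> \<in> M" using ec by (simp add: minus_eq a_assoc l_neg)
  then have "M = carrier R" by (rule left_ideal_one_eq_carrier[OF LM])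
  then show False using M(1) by (simp add: maximal_left_ideal_def)
qed


section \<open>Matrix units modulo the radical\<close>

locale field_algebra = ring A for A :: "('f::field, 'b) module" (structure) +
  assumes smult_closed [simp, intro]: "u \<in> carrier A \<Longrightarrow> c \<odot> u \<in> carrier A"
    and smult_l_distr: "u \<in> carrier A \<Longrightarrow> (c + d) \<odot> u = c \<odot> u \<oplus> d \<odot> u"
    and smult_r_distr: "u \<in> carrier A \<Longrightarrow> v \<in> carrier A \<Longrightarrow> c \<odot> (u \<oplus> v) = c \<odot> u \<oplus> c \<odot> v"
    and smult_assoc: "u \<in> carrier A \<Longrightarrow> (c * d) \<odot> u = c \<odot> (d \<odot> u)"
    and smult_one [simp]: "u \<in> carrier A \<Longrightarrow> 1 \<odot> u = u"
    and smult_mult_left: "u \<in> carrier A \<Longrightarrow> v \<in> carrier A \<Longrightarrow> c \<odot> u \<otimes> v = c \<odot> (u \<otimes> v)"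
    and smult_mult_right: "u \<in> carrier A \<Longrightarrow> v \<in> carrier A \<Longrightarrow> u \<otimes> (c \<odot> v) = c \<odot> (u \<otimes> v)"
begin

lemma smult_zero_left [simp]: "u \<in> carrier A \<Longrightarrow> 0 \<odot> u = \<zero>"
  using smult_l_distr[of u 0 0] by simp

lemma smult_zero_right [simp]: "c \<odot> \<zero> = \<zero>"
  using smult_mult_left[of \<zero> \<zero> c] by (metis r_null smult_closed zero_closed)

text \<open>Scaling by \<open>c\<close> is left multiplication by
  \<open>c \<odot> \<one>\<close>.\<close>

lemma ideal_smult_mem:
  assumes "ideal I A" "u \<in> I"
  shows "c \<odot> u \<in> I"
proof -
  interpret ideal I A by fact
  have u: "u \<in> carrier A" using assms(2) a_subset by blast
  have "c \<odot> \<one> \<otimes> u \<in> I" using I_l_closed[OF assms(2)] by simp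
  then show ?thesis using u by (simp add: smult_mult_left)
qed

text \<open>\<open>finsum\<close> depends only on the additive part of the record, so sums in the
  factor algebra can be computed in \<open>A Quot I\<close>, where the ring laws are
  available.\<close>

lemma quot_alg_sel:
  "mult (quot_alg A I) = mult (A Quot I)"
  "finsum (quot_alg A I) = finsum (A Quot I)"
  "c \<odot>\<^bsub>quot_alg A I\<^esub> C = (\<Union>u\<in>C. I +> (c \<odot> u))"
  by (simp_all add: quot_alg_def ring.defs module.defs FactRing_def finsum_def finprod_def fun_eq_iff)

lemma quot_alg_mult:
  assumes "ideal I A" "u \<in> carrier A" "v \<in> carrier A"
  shows "(I +> u) \<otimes>\<^bsub>quot_alg A I\<^esub> (I +> v) = I +> (u \<otimes> v)"
  using ideal.rcoset_mult_add[OF assms] by (simp add: quot_alg_sel FactRing_def)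

text \<open>The scalar multiple is defined as a union over all representatives. Two of them differ
  by an element of \<open>I\<close>, which absorbs scalars, so the cosets in the union
  coincide.\<close>

lemma quot_alg_smult:
  assumes I: "ideal I A" and u: "u \<in> carrier A"
  shows "c \<odot>\<^bsub>quot_alg A I\<^esub> (I +> u) = I +> (c \<odot> u)"
proof -
  interpret ideal I A by fact
  have "I +> (c \<odot> v) = I +> (c \<odot> u)" if v: "v \<in> I +> u" for v
  proof -
    obtain w where w: "w \<in> I" "v = w \<oplus> u" using v by (auto simp: a_r_coset_def')
    have wc: "w \<in> carrier A" using w(1) a_subset by blast
    have "c \<odot> v = c \<odot> w \<oplus> c \<odot> u" using w wc u by (simp add: smult_r_distr)
    then have "c \<odot> v \<in> I +> (c \<odot> u)"
      using ideal_smult_mem[OF I w(1)] by (auto simp: a_r_coset_def')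
    then show ?thesis using u a_repr_independence' by (metis smult_closed)
  qed
  moreover have "I +> u \<noteq> {}" using a_rcos_self[OF u] by blast
  ultimately have "(\<Union>v\<in>I +> u. I +> (c \<odot> v)) = I +> (c \<odot> u)" by (intro SUP_eq_const)
  then show ?thesis by (simp only: quot_alg_sel(3))
qed

lemma quot_alg_finsum:
  assumes I: "ideal I A" and f: "f \<in> S \<rightarrow> carrier A"
  shows "(\<Oplus>\<^bsub>quot_alg A I\<^esub>s\<in>S. I +> f s) = I +> (\<Oplus>s\<in>S. f s)"
proof -
  interpret ideal I A by fact
  interpret Q: ring "A Quot I" by (rule quotient_is_ring)
  have hom: "(+>) I \<in> ring_hom A (A Quot I)" by (rule rcos_ring_hom)
  have "(\<Oplus>\<^bsub>A Quot I\<^esub>s\<in>S. I +> f s) = I +> (\<Oplus>s\<in>S. f s)"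
    using f
  \<comment> \<open>For infinite \<open>S\<close> both sums take the default value zero, and the
    coset of zero is the zero of the factor ring.\<close>
  proof (induction S rule: infinite_finite_induct)
    case (insert s S)
    have "(\<lambda>s. I +> f s) \<in> S \<rightarrow> carrier (A Quot I)" "I +> f s \<in> carrier (A Quot I)"
      using insert.prems ring_hom_closed[OF hom] by auto
    then show ?case
      using insert ring_hom_add[OF hom, of "f s" "finsum A f S"] by simp
  qed (use I in \<open>simp_all add: ring_hom_zero[OF hom] ring_axioms Q.ring_axioms\<close>)
  then show ?thesis by (simp add: quot_alg_sel)
qed

text \<open>Sandwiching a combination of the family between two copies of \<open>D (\<tau> t)\<close> isolates the
  coefficient at \<open>t\<close>, and \<open>D (\<tau> t) \<otimes> D t\<close> is a nonzero idempotent, hence not in the radical.\<close>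

lemma matrix_units_coeff_zero:
  assumes S: "finite S" and D: "D \<in> S \<rightarrow> carrier A" and \<tau>: "\<tau> \<in> S \<rightarrow> S"
    and unit: "\<And>s t. s \<in> S \<Longrightarrow> t \<in> S \<Longrightarrow>
      D (\<tau> t) \<otimes> D s \<otimes> D (\<tau> t) = (if s = t then D (\<tau> t) else \<zero>)"
    and nz: "\<And>t. t \<in> S \<Longrightarrow> D t \<noteq> \<zero>"
    and rad: "(\<Oplus>s\<in>S. c s \<odot> D s) \<in> jacobson_radical A" and t: "t \<in> S"
  shows "c t = 0"
proof (rule ccontr)
  assume c: "c t \<noteq> 0"
  interpret ideal "jacobson_radical A" A by (rule jacobson_radical_ideal)
  have Dc: "D s \<in> carrier A" if "s \<in> S" for s using D that by blast
  let ?e = "D (\<tau> t)"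
  have ts: "\<tau> t \<in> S" using \<tau> t by blast
  have e: "?e \<in> carrier A" using Dc ts by blast
  have "?e \<otimes> (\<Oplus>s\<in>S. c s \<odot> D s) \<otimes> ?e = (\<Oplus>s\<in>S. ?e \<otimes> (c s \<odot> D s) \<otimes> ?e)"
    using S Dc e by (simp add: finsum_rdistr finsum_ldistr Pi_def)
  also have "\<dots> = (\<Oplus>s\<in>S. if t = s then c s \<odot> ?e else \<zero>)"
  proof (rule finsum_cong')
    fix s assume s: "s \<in> S"
    show "?e \<otimes> (c s \<odot> D s) \<otimes> ?e = (if t = s then c s \<odot> ?e else \<zero>)"
      using unit[OF s t] Dc[OF s] e by (auto simp: smult_mult_left smult_mult_right)
  qed (use e in auto)
  also have "\<dots> = c t \<odot> ?e"
    using t S e by (intro add.finprod_singleton) auto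
  finally have "c t \<odot> ?e \<in> jacobson_radical A"
    using rad e by (metis I_l_closed I_r_closed)
  then have "inverse (c t) \<odot> (c t \<odot> ?e) \<in> jacobson_radical A"
    by (rule ideal_smult_mem[OF jacobson_radical_ideal])
  then have "?e \<in> jacobson_radical A"
    using c e by (simp flip: smult_assoc)
  then have "?e \<otimes> D t \<in> jacobson_radical A" using Dc t by (simp add: I_r_closed)
  moreover have "(?e \<otimes> D t) \<otimes> (?e \<otimes> D t) = ?e \<otimes> D t"
    using unit[OF t t] Dc[OF t] e by (simp flip: m_assoc)
  ultimately have "?e \<otimes> D t = \<zero>" by (rule idempotent_in_jacobson_radical)
  \<comment> \<open>Multiplying \<open>?e \<otimes> D t\<close> by \<open>?e\<close> on the right
    gives back \<open>?e\<close>, so this idempotent can vanish only if \<open>?e\<close>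
    does.\<close>
  then have "?e = \<zero>" using unit[OF t t] e by simp
  then show False using nz ts by blast
qed

text \<open>The description in \<open>basis_coeff\<close> must have exactly one solution. This needs
  distinct cosets for distinct indices, and zero coefficients for every combination falling into the
  radical.\<close>

lemma matrix_units_basis_coeff:
  assumes S: "finite S" and D: "D \<in> S \<rightarrow> carrier A" and \<tau>: "\<tau> \<in> S \<rightarrow> S"
    and unit: "\<And>s t. s \<in> S \<Longrightarrow> t \<in> S \<Longrightarrow>
      D (\<tau> t) \<otimes> D s \<otimes> D (\<tau> t) = (if s = t then D (\<tau> t) else \<zero>)"
    and nz: "\<And>t. t \<in> S \<Longrightarrow> D t \<noteq> \<zero>"
    and t: "t \<in> S"
  defines "J \<equiv> jacobson_radical A"
  shows "basis_coeff (quot_alg A J) ((\<lambda>s. J +> D s) ` S) (J +> (\<Oplus>s\<in>S. c s \<odot> D s)) (J +> D t) = c t"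
proof -
  have J: "ideal J A" unfolding J_def by (rule jacobson_radical_ideal)
  interpret ideal J A by (rule J)
  interpret Q: ring "A Quot J" by (rule quotient_is_ring)
  have Dc: "D s \<in> carrier A" if "s \<in> S" for s using D that by blast
  have comb: "(\<Oplus>s\<in>S. d s \<odot> D s) \<in> carrier A" for d
    using Dc by (intro finsum_closed) auto
  \<comment> \<open>Two expansions of the same coset differ by a combination in the radical, to
    which \<open>matrix_units_coeff_zero\<close> applies.\<close>
  have eq: "d s = d' s"
    if "J +> (\<Oplus>s\<in>S. d s \<odot> D s) = J +> (\<Oplus>s\<in>S. d' s \<odot> D s)" "s \<in> S" for d d' s
  proof -
    have "(\<Oplus>s\<in>S. (d s - d' s) \<odot> D s) \<oplus> (\<Oplus>s\<in>S. d' s \<odot> D s)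
        = (\<Oplus>s\<in>S. (d s - d' s) \<odot> D s \<oplus> d' s \<odot> D s)"
      using Dc by (subst finsum_addf) auto
    also have "\<dots> = (\<Oplus>s\<in>S. d s \<odot> D s)"
      using Dc by (intro finsum_cong') (auto simp flip: smult_l_distr)
    finally have sum: "(\<Oplus>s\<in>S. d s \<odot> D s)
      = (\<Oplus>s\<in>S. (d s - d' s) \<odot> D s) \<oplus> (\<Oplus>s\<in>S. d' s \<odot> D s)" by simp
    have "(\<Oplus>s\<in>S. (d s - d' s) \<odot> D s) = (\<Oplus>s\<in>S. d s \<odot> D s) \<ominus> (\<Oplus>s\<in>S. d' s \<odot> D s)"
      unfolding sum using comb by (simp add: minus_eq a_assoc r_neg)
    also have "\<dots> \<in> J"
      using that(1) comb J quotient_eq_iff_same_a_r_cos by metis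
    finally have "d s - d' s = 0"
      using matrix_units_coeff_zero[OF S D \<tau> unit nz, of "\<lambda>s. d s - d' s" s] that(2)
      by (simp add: J_def)
    then show ?thesis by simp
  qed
  have inj: "inj_on (\<lambda>s. J +> D s) S"
  proof (rule inj_onI)
    fix s s' assume ss: "s \<in> S" "s' \<in> S" and co: "J +> D s = J +> D s'"
    have one: "(\<Oplus>r\<in>S. of_bool (r = q) \<odot> D r) = D q" if q: "q \<in> S" for q
    proof -
      have "(\<Oplus>r\<in>S. of_bool (r = q) \<odot> D r) = (\<Oplus>r\<in>S. if q = r then D r else \<zero>)"
        using Dc by (intro finsum_cong') auto
      also have "\<dots> = D q" using q S D by (rule add.finprod_singleton)
      finally show ?thesis .
    qed
    \<comment> \<open>Each \<open>D q\<close> is the combination with Kronecker coefficients, so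
      equal cosets force equal Kronecker functions.\<close>
    have "of_bool (s = s) = (of_bool (s = s') :: 'f)"
      using co one[OF ss(1)] one[OF ss(2)]
      by (intro eq[of "\<lambda>r. of_bool (r = s)" "\<lambda>r. of_bool (r = s')" s] ss(1)) simp
    then show "s = s'" by (simp split: if_splits)
  qed
  let ?B = "(\<lambda>s. J +> D s) ` S"
  have expand: "(\<Oplus>\<^bsub>quot_alg A J\<^esub>u\<in>?B. d u \<odot>\<^bsub>quot_alg A J\<^esub> u)
      = J +> (\<Oplus>s\<in>S. d (J +> D s) \<odot> D s)" for d
  proof -
    have cl: "d (J +> D s) \<odot>\<^bsub>quot_alg A J\<^esub> (J +> D s) = J +> (d (J +> D s) \<odot> D s)" if "s \<in> S" for s
      using quot_alg_smult[OF J Dc[OF that]] .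
    have mem: "J +> u \<in> carrier (A Quot J)" if "u \<in> carrier A" for u
      using ring_hom_closed[OF rcos_ring_hom that] .
    \<comment> \<open>Distinctness of the cosets turns the sum over the basis, a set of cosets, into
      a sum over the indices.\<close>
    have "(\<Oplus>\<^bsub>A Quot J\<^esub>u\<in>?B. d u \<odot>\<^bsub>quot_alg A J\<^esub> u)
        = (\<Oplus>\<^bsub>A Quot J\<^esub>s\<in>S. d (J +> D s) \<odot>\<^bsub>quot_alg A J\<^esub> (J +> D s))"
      using cl mem Dc inj by (intro Q.add.finprod_reindex) auto
    also have "\<dots> = (\<Oplus>\<^bsub>A Quot J\<^esub>s\<in>S. J +> (d (J +> D s) \<odot> D s))"
      using cl mem Dc by (intro Q.finsum_cong') auto
    finally show ?thesis
      using quot_alg_finsum[OF J, of "\<lambda>s. d (J +> D s) \<odot> D s" S] Dc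
      by (simp add: quot_alg_sel)
  qed
  \<comment> \<open>The solution transports \<open>c\<close> along the index bijection and is
    \<open>undefined\<close> off the basis, as the extensionality in \<open>basis_coeff\<close>
    requires.\<close>
  define C where "C = (\<lambda>u\<in>?B. c (the_inv_into S (\<lambda>s. J +> D s) u))"
  have C: "C (J +> D s) = c s" if "s \<in> S" for s
    using that the_inv_into_f_f[OF inj that] by (simp add: C_def)
  have "(THE d. d \<in> ?B \<rightarrow>\<^sub>E UNIV \<and> J +> (\<Oplus>s\<in>S. c s \<odot> D s)
      = (\<Oplus>\<^bsub>quot_alg A J\<^esub>u\<in>?B. d u \<odot>\<^bsub>quot_alg A J\<^esub> u)) = C"
  proof (rule the_equality)
    have "(\<Oplus>s\<in>S. C (J +> D s) \<odot> D s) = (\<Oplus>s\<in>S. c s \<odot> D s)"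
      using Dc C by (intro finsum_cong') auto
    then show "C \<in> ?B \<rightarrow>\<^sub>E UNIV \<and> J +> (\<Oplus>s\<in>S. c s \<odot> D s)
      = (\<Oplus>\<^bsub>quot_alg A J\<^esub>u\<in>?B. C u \<odot>\<^bsub>quot_alg A J\<^esub> u)"
      by (auto simp: expand C_def)
  next
    fix d assume d: "d \<in> ?B \<rightarrow>\<^sub>E UNIV \<and> J +> (\<Oplus>s\<in>S. c s \<odot> D s)
      = (\<Oplus>\<^bsub>quot_alg A J\<^esub>u\<in>?B. d u \<odot>\<^bsub>quot_alg A J\<^esub> u)"
    show "d = C"
    proof (rule extensionalityI)
      show "d \<in> extensional ?B" using d by (simp add: PiE_def)
      show "C \<in> extensional ?B" by (simp add: C_def)
      fix u assume "u \<in> ?B"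
      then obtain s where s: "s \<in> S" "u = J +> D s" by blast
      have "c s = d (J +> D s)"
        using d s(1) by (intro eq[of c "\<lambda>s. d (J +> D s)"]) (simp_all only: expand)
      then show "d u = C u" using C s by simp
    qed
  qed
  then show ?thesis using C[OF t] by (simp add: basis_coeff_def)
qed

end

section \<open>Matrix algebras\<close>

lemma mat_alg_simps:
  "carrier (mat_alg X) = {M. \<forall>y z. y \<notin> X \<or> z \<notin> X \<longrightarrow> M y z = 0}"
  "mult (mat_alg X) = (\<lambda>M N y z. \<Sum>w\<in>X. M y w * N w z)"
  "one (mat_alg X) = (\<lambda>y z. if y \<in> X \<and> y = z then 1 else 0)"
  "zero (mat_alg X) = (\<lambda>y z. 0)"
  "add (mat_alg X) = (\<lambda>M N y z. M y z + N y z)"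
  "smult (mat_alg X) = (\<lambda>c M y z. c * M y z)"
  by (simp_all add: mat_alg_def)

lemma ring_mat_alg:
  fixes X :: "'x set"
  assumes "finite X"
  shows "ring (mat_alg X :: ('f::field, 'x \<Rightarrow> 'x \<Rightarrow> 'f) module)"
proof (rule ringI)
  show "abelian_group (mat_alg X :: ('f, 'x \<Rightarrow> 'x \<Rightarrow> 'f) module)"
  proof (rule abelian_groupI)
    fix M :: "'x \<Rightarrow> 'x \<Rightarrow> 'f" assume "M \<in> carrier (mat_alg X)"
    then show "\<exists>N\<in>carrier (mat_alg X). N \<oplus>\<^bsub>mat_alg X\<^esub> M = \<zero>\<^bsub>mat_alg X\<^esub>"
      by (intro bexI[of _ "\<lambda>y z. - M y z"]) (auto simp: mat_alg_simps)
  qed (auto simp: mat_alg_simps add_ac)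
  show "Group.monoid (mat_alg X :: ('f, 'x \<Rightarrow> 'x \<Rightarrow> 'f) module)"
  proof (rule monoidI)
    fix M N K :: "'x \<Rightarrow> 'x \<Rightarrow> 'f"
    assume "M \<in> carrier (mat_alg X)" "N \<in> carrier (mat_alg X)" "K \<in> carrier (mat_alg X)"
    show "M \<otimes>\<^bsub>mat_alg X\<^esub> N \<otimes>\<^bsub>mat_alg X\<^esub> K = M \<otimes>\<^bsub>mat_alg X\<^esub> (N \<otimes>\<^bsub>mat_alg X\<^esub> K)"
    proof (intro ext)
      fix y z
      have "(\<Sum>w\<in>X. (\<Sum>v\<in>X. M y v * N v w) * K w z) = (\<Sum>w\<in>X. \<Sum>v\<in>X. M y v * (N v w * K w z))"
        by (simp add: sum_distrib_right mult.assoc)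
      also have "\<dots> = (\<Sum>v\<in>X. \<Sum>w\<in>X. M y v * (N v w * K w z))" by (rule sum.swap)
      also have "\<dots> = (\<Sum>v\<in>X. M y v * (\<Sum>w\<in>X. N v w * K w z))"
        by (simp add: sum_distrib_left)
      finally show "(M \<otimes>\<^bsub>mat_alg X\<^esub> N \<otimes>\<^bsub>mat_alg X\<^esub> K) y z
        = (M \<otimes>\<^bsub>mat_alg X\<^esub> (N \<otimes>\<^bsub>mat_alg X\<^esub> K)) y z"
        by (simp add: mat_alg_simps)
    qed
  next
    fix M :: "'x \<Rightarrow> 'x \<Rightarrow> 'f" assume M: "M \<in> carrier (mat_alg X)"
    have "(\<Sum>w\<in>X. (if y \<in> X \<and> y = w then 1 else 0) * M w z) = M y z" for y z
    proof -
      have "(\<Sum>w\<in>X. (if y \<in> X \<and> y = w then 1 else 0) * M w z) = (\<Sum>w\<in>X. if w = y then M y z else 0)"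
        by (intro sum.cong) auto
      then show ?thesis using M assms by (auto simp: mat_alg_simps)
    qed
    moreover have "(\<Sum>w\<in>X. M y w * (if w \<in> X \<and> w = z then 1 else 0)) = M y z" for y z
    proof -
      have "(\<Sum>w\<in>X. M y w * (if w \<in> X \<and> w = z then 1 else 0)) = (\<Sum>w\<in>X. if w = z then M y z else 0)"
        by (intro sum.cong) auto
      then show ?thesis using M assms by (auto simp: mat_alg_simps)
    qed
    ultimately show "\<one>\<^bsub>mat_alg X\<^esub> \<otimes>\<^bsub>mat_alg X\<^esub> M = M" "M \<otimes>\<^bsub>mat_alg X\<^esub> \<one>\<^bsub>mat_alg X\<^esub> = M"
      unfolding mat_alg_simps by presburger+
  qed (auto simp: mat_alg_simps)
qed (auto simp: mat_alg_simps sum.distrib distrib_left distrib_right)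

lemma field_algebra_mat_alg:
  fixes X :: "'x set"
  assumes "finite X"
  shows "field_algebra (mat_alg X :: ('f::field, 'x \<Rightarrow> 'x \<Rightarrow> 'f) module)"
proof -
  interpret ring "mat_alg X :: ('f, 'x \<Rightarrow> 'x \<Rightarrow> 'f) module" by (rule ring_mat_alg[OF assms])
  show ?thesis
    by unfold_locales
      (auto simp: mat_alg_simps algebra_simps sum_distrib_left)
qed

lemma (in field_algebra) subalgebra_generated:
  assumes "G \<subseteq> carrier A"
  shows "is_subalgebra (carrier (generated_subalgebra A G)) A"
    and "G \<subseteq> carrier (generated_subalgebra A G)"
proof -
  let ?F = "{S. is_subalgebra S A \<and> G \<subseteq> S}"
  have "carrier A \<in> ?F"
    using assms carrier_is_subring by (auto simp: is_subalgebra_def)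
  then have "subring (\<Inter>?F) A"
    by (intro subring_Inter) (auto simp: is_subalgebra_def)
  then show "is_subalgebra (carrier (generated_subalgebra A G)) A"
    by (auto simp: is_subalgebra_def generated_subalgebra_def)
  show "G \<subseteq> carrier (generated_subalgebra A G)"
    by (auto simp: generated_subalgebra_def)
qed

lemma (in field_algebra) field_algebra_subalgebra:
  assumes "is_subalgebra S A"
  shows "field_algebra (A\<lparr>carrier := S\<rparr>)"
proof -
  have S: "subring S A" and sm: "\<And>c u. u \<in> S \<Longrightarrow> c \<odot> u \<in> S"
    using assms by (auto simp: is_subalgebra_def)
  have c: "u \<in> carrier A" if "u \<in> S" for u using subringE(1)[OF S] that by blast
  interpret S: ring "A\<lparr>carrier := S\<rparr>" by (rule subring_is_ring[OF S])
  show ?thesis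
    by unfold_locales
      (auto simp: c sm smult_l_distr smult_r_distr smult_assoc smult_mult_left smult_mult_right)
qed

text \<open>\<open>BB\<close> and \<open>DD\<close> are pointwise sums of functions rather than ring
  sums; this gives their membership in the subalgebra.\<close>

lemma mat_subalgebra_sum:
  assumes S: "is_subalgebra S (mat_alg X)"
    and f: "\<And>t. t \<in> T \<Longrightarrow> f t \<in> S"
  shows "(\<lambda>y z. \<Sum>t\<in>T. f t y z) \<in> S"
  using f
proof (induction T rule: infinite_finite_induct)
  case (insert t T)
  have "f t \<oplus>\<^bsub>mat_alg X\<^esub> (\<lambda>y z. \<Sum>t\<in>T. f t y z) \<in> S"
    using S insert by (intro subringE(7)) (auto simp: is_subalgebra_def)
  then show ?case using insert.hyps by (simp add: mat_alg_simps)
qed (use S subringE(2)[of S "mat_alg X"] in \<open>auto simp: is_subalgebra_def mat_alg_simps\<close>)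

lemma mat_subalgebra_smult:
  assumes "is_subalgebra S (mat_alg X)" "M \<in> S"
  shows "(\<lambda>y z. c * M y z) \<in> S"
  using assms by (force simp: is_subalgebra_def mat_alg_simps)

section \<open>Supports and entries\<close>

lemma supp_with_supp [simp]: "supp n (with_supp n V) = V \<inter> {1..n}"
  by (auto simp: supp_def with_supp_def)

lemma with_supp_in_EE [simp]: "with_supp n V \<in> EE n"
  by (auto simp: with_supp_def EE_def)

lemma with_supp_supp: "g \<in> EE n \<Longrightarrow> with_supp n (supp n g) = g"
  by (rule extensionalityI[of _ "{1..n}"])
    (auto simp: with_supp_def supp_def EE_def PiE_iff)

lemma supp_eq_iff: "g \<in> EE n \<Longrightarrow> h \<in> EE n \<Longrightarrow> supp n g = supp n h \<longleftrightarrow> g = h"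
  by (metis with_supp_supp)

lemma supp_subset: "supp n g \<subseteq> {1..n}"
  by (auto simp: supp_def)

lemma finite_supp [simp]: "finite (supp n g)"
  by (rule finite_subset[OF supp_subset]) simp

lemma finite_EE: "finite (EE n)"
  unfolding EE_def by (intro finite_PiE) auto

lemma finite_PP: "finite (PP n U)"
  by (rule finite_subset[of _ "EE n \<times> EE n \<times> EE n"]) (auto simp: PP_def finite_EE)

lemma rel_iff:
  "(y, z) \<in> rel n U j \<longleftrightarrow> y \<in> pts n U \<and> z \<in> pts n U \<and> supp n j = {a \<in> {1..n}. y a \<noteq> z a}"
proof -
  have "(\<forall>a\<in>{1..n}. (y a \<noteq> z a) = (j a = 1)) \<longleftrightarrow> supp n j = {a \<in> {1..n}. y a \<noteq> z a}"
    unfolding supp_def by blast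
  then show ?thesis by (simp only: rel_def mem_Collect_eq case_prod_conv)
qed

lemma valency_nonzero_iff:
  "of_nat (valency n U g) \<noteq> (0::'f::field) \<longleftrightarrow> (\<forall>a\<in>supp n g. of_nat (card (U a) - 1) \<noteq> (0::'f))"
  unfolding valency_def of_nat_prod prod_zero_iff[OF finite_supp] by blast

lemma not_CHAR_dvd_valency_iff:
  "\<not> CHAR('f::field) dvd valency n U g \<longleftrightarrow> (\<forall>a\<in>supp n g. of_nat (card (U a) - 1) \<noteq> (0::'f))"
  using valency_nonzero_iff[of n U g, where 'f='f] by (simp only: of_nat_eq_0_iff_char_dvd)

lemma dual_adj_dual_entry:
  fixes x :: "nat \<Rightarrow> 'u"
  assumes "finite (pts n U)" "y \<in> pts n U" "z \<in> pts n U"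
  shows "(dual_idem n U x g \<otimes>\<^bsub>mat_alg (pts n U)\<^esub> adj n U j \<otimes>\<^bsub>mat_alg (pts n U)\<^esub> dual_idem n U x i) y z
    = (of_bool ((x, y) \<in> rel n U g \<and> (x, z) \<in> rel n U i \<and> (y, z) \<in> rel n U j) :: 'f::field)"
proof -
  have "(\<Sum>v\<in>pts n U. dual_idem n U x g y v * adj n U j v w)
      = of_bool ((x, y) \<in> rel n U g) * (adj n U j y w :: 'f)" for w
  proof -
    have "(\<Sum>v\<in>pts n U. dual_idem n U x g y v * adj n U j v w)
      = (\<Sum>v\<in>pts n U. if v = y then of_bool ((x, y) \<in> rel n U g) * (adj n U j y w :: 'f) else 0)"
      by (intro sum.cong) (auto simp: dual_idem_def)
    then show ?thesis using assms by simp
  qed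
  then have "(dual_idem n U x g \<otimes>\<^bsub>mat_alg (pts n U)\<^esub> adj n U j \<otimes>\<^bsub>mat_alg (pts n U)\<^esub> dual_idem n U x i) y z
    = (\<Sum>w\<in>pts n U. of_bool ((x, y) \<in> rel n U g) * adj n U j y w * (dual_idem n U x i w z :: 'f))"
    by (simp add: mat_alg_simps)
  also have "\<dots> = (\<Sum>w\<in>pts n U. if w = z then of_bool ((x, y) \<in> rel n U g) * adj n U j y z * of_bool ((x, z) \<in> rel n U i) else 0)"
    by (intro sum.cong) (auto simp: dual_idem_def)
  finally show ?thesis using assms by (simp add: adj_def)
qed

text \<open>For given \<open>y\<close> and \<open>z\<close> only one \<open>j\<close> can
  contribute, the one supported where they differ. The lower bound on its support is then automatic:
  where exactly one of \<open>y\<close>, \<open>z\<close> agrees with \<open>x\<close>, they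
  differ.\<close>

lemma BB_entry:
  fixes x :: "nat \<Rightarrow> 'u"
  assumes "finite (pts n U)" "y \<in> pts n U" "z \<in> pts n U"
  shows "BB n U x g h i y z
    = (of_bool ((x, y) \<in> rel n U g \<and> (x, z) \<in> rel n U i \<and> {a \<in> {1..n}. y a \<noteq> z a} \<subseteq> supp n h) :: 'f::field)"
proof -
  let ?J = "{j \<in> EE n. sym_diff (supp n g) (supp n i) \<subseteq> supp n j \<and> supp n j \<subseteq> supp n h}"
  let ?d = "with_supp n {a \<in> {1..n}. y a \<noteq> z a}"
  have d: "(y, z) \<in> rel n U j \<longleftrightarrow> j = ?d" if "j \<in> EE n" for j
  proof -
    have "{a \<in> {1..n}. y a \<noteq> z a} \<inter> {1..n} = {a \<in> {1..n}. y a \<noteq> z a}" by blast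
    then show ?thesis
      using assms supp_eq_iff[OF that, of ?d] unfolding rel_iff supp_with_supp by simp
  qed
  have fin: "finite ?J" using finite_EE by simp
  have "BB n U x g h i y z = (\<Sum>j\<in>?J. if j = ?d then of_bool ((x, y) \<in> rel n U g \<and> (x, z) \<in> rel n U i) else (0::'f))"
    unfolding BB_def dual_adj_dual_entry[OF assms] by (intro sum.cong) (auto simp: d)
  also have "\<dots> = (if ?d \<in> ?J then of_bool ((x, y) \<in> rel n U g \<and> (x, z) \<in> rel n U i) else 0)"
    using fin by (rule sum.delta)
  also have "\<dots> = of_bool (?d \<in> ?J \<and> (x, y) \<in> rel n U g \<and> (x, z) \<in> rel n U i)"
    by (simp only: of_bool_def split: if_split) blast
  also have "(?d \<in> ?J \<and> (x, y) \<in> rel n U g \<and> (x, z) \<in> rel n U i)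
      \<longleftrightarrow> ((x, y) \<in> rel n U g \<and> (x, z) \<in> rel n U i \<and> {a \<in> {1..n}. y a \<noteq> z a} \<subseteq> supp n h)"
    by (auto simp: rel_iff)
  finally show ?thesis .
qed

section \<open>Products in a single coordinate\<close>

text \<open>\<open>b\<close> is the base point and \<open>G, H, I\<close> tell whether the coordinate lies in the supports of
  \<open>g, h, i\<close>. If the characteristic divides \<open>card V - 1\<close>, the term subtracted in the last line vanishes
  by \<open>inverse 0 = 0\<close>, in accordance with the restriction on \<open>k\<^sub>l\<close> in the definition of \<open>D\<close>.\<close>

definition coord_entry :: "'u set \<Rightarrow> 'u \<Rightarrow> bool \<Rightarrow> bool \<Rightarrow> bool \<Rightarrow> 'u \<Rightarrow> 'u \<Rightarrow> 'f::field" where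
  "coord_entry V b G H I y z = of_bool ((y \<noteq> b) = G) * of_bool ((z \<noteq> b) = I) *
    (if H then if I then inverse (of_nat (card V - 1)) else 1
     else of_bool (y = z) - of_bool (2 < card V \<and> G \<and> I) * inverse (of_nat (card V - 1)))"

text \<open>Away from the base point, identity and all-one blocks and their combinations have
  entries \<open>\<alpha> + \<beta> * of_bool (y = u)\<close>, so this formula covers all their
  products.\<close>

lemma sum_affine_indicators:
  fixes \<alpha> :: "'f::field"
  assumes "finite W"
  shows "(\<Sum>u\<in>W. (\<alpha> + \<beta> * of_bool (y = u)) * (\<gamma> + \<delta> * of_bool (u = z)))
    = \<alpha> * \<gamma> * of_nat (card W) + \<alpha> * \<delta> * of_bool (z \<in> W) + \<beta> * \<gamma> * of_bool (y \<in> W)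
      + \<beta> * \<delta> * of_bool (y = z \<and> y \<in> W)"
proof -
  have "(\<Sum>u\<in>W. (\<alpha> + \<beta> * of_bool (y = u)) * (\<gamma> + \<delta> * of_bool (u = z)))
    = (\<Sum>u\<in>W. \<alpha> * \<gamma> + (if u = z then \<alpha> * \<delta> else 0) + (if u = y then \<beta> * \<gamma> else 0)
        + (if u = y then \<beta> * \<delta> * of_bool (y = z) else 0))"
    by (intro sum.cong) (auto simp: algebra_simps)
  then show ?thesis using assms by (simp add: sum.distrib)
qed

text \<open>The all-one block divided by \<open>card V - 1\<close> and its complement are orthogonal
  idempotents, and blocks involving the base point behave like the all-one block. So the product
  survives exactly when both factors are of complement type or neither is. If
  \<open>card V - 1\<close> vanishes in the field, \<open>H\<close> and \<open>K\<close> are false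
  and only identity blocks occur.\<close>

lemma coord_entry_mult:
  fixes V :: "'u set"
  assumes V: "finite V" "2 \<le> card V" "b \<in> V" "y \<in> V" "z \<in> V"
    and H: "G \<noteq> I \<Longrightarrow> H" "H \<Longrightarrow> G \<noteq> I \<or> G \<and> I \<and> 2 < card V" "H \<Longrightarrow> of_nat (card V - 1) \<noteq> (0::'f::field)"
    and K: "I \<noteq> L \<Longrightarrow> K" "K \<Longrightarrow> I \<noteq> L \<or> I \<and> L \<and> 2 < card V" "K \<Longrightarrow> of_nat (card V - 1) \<noteq> (0::'f)"
  shows "(\<Sum>u\<in>V. coord_entry V b G H I y u * coord_entry V b I K L u z)
    = (if (G \<and> I \<and> 2 < card V \<and> \<not> H) = (I \<and> L \<and> 2 < card V \<and> \<not> K)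
       then coord_entry V b G (G \<noteq> L \<or> G \<and> L \<and> 2 < card V \<and> \<not> I \<or> (H \<or> K) \<and> G \<and> I \<and> L \<and> 2 < card V) L y z
       else (0::'f))"
proof -
  define \<kappa> where "\<kappa> = (of_nat (card V - 1) :: 'f)"
  note entry = coord_entry_def[where 'f = 'f, of V, folded \<kappa>_def]
  have HK: "G \<noteq> I \<longrightarrow> H" "H \<longrightarrow> G \<noteq> I \<or> G \<and> I \<and> 2 < card V" "H \<longrightarrow> \<kappa> \<noteq> 0"
    "I \<noteq> L \<longrightarrow> K" "K \<longrightarrow> I \<noteq> L \<or> I \<and> L \<and> 2 < card V" "K \<longrightarrow> \<kappa> \<noteq> 0"
    using H K by (auto simp: \<kappa>_def)
  \<comment> \<open>Two points leave a single non-base point, where identity and all-one block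
    coincide; this fact and the next one settle that case.\<close>
  have \<kappa>1: "\<kappa> = 1" if "\<not> 2 < card V"
  proof -
    have "card V = 2" using that V(2) by simp
    then show ?thesis by (simp add: \<kappa>_def)
  qed
  have small: "y = z" if "\<not> 2 < card V" "y \<noteq> b" "z \<noteq> b"
  proof -
    have "card V = 2" using that(1) V(2) by simp
    then obtain p q where "V = {p, q}" by (auto simp: card_2_iff)
    then show ?thesis using that V by auto
  qed
  show ?thesis
  proof (cases "(y \<noteq> b) = G \<and> (z \<noteq> b) = L")
    case False
    then have "coord_entry V b G H I y u * coord_entry V b I K L u z = (0::'f)" for u
      by (auto simp: entry)
    then show ?thesis using False by (auto simp: entry)
  next
    case yz: True
    show ?thesis
    proof (cases I)
      case False
      have "(\<Sum>u\<in>V. coord_entry V b G H I y u * coord_entry V b I K L u z)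
        = (\<Sum>u\<in>V. if u = b then coord_entry V b G H I y b * coord_entry V b I K L b z else (0::'f))"
        using False by (intro sum.cong) (auto simp: coord_entry_def)
      also have "\<dots> = coord_entry V b G H I y b * coord_entry V b I K L b z"
        using V by simp
      finally show ?thesis
        using False HK small \<kappa>1 yz by (cases G; cases L; cases "2 < card V") (auto simp: entry)
    next
      case True
      let ?w = "inverse \<kappa>"
      let ?W = "V - {b}"
      have cW: "card ?W = card V - 1" using V by simp
      \<comment> \<open>These are the constant and the diagonal parts of the two factors as
        functions of \<open>u \<noteq> b\<close>.\<close>
      define \<alpha> \<beta> \<gamma> \<delta> where "\<alpha> = (if H then ?w else - of_bool (2 < card V \<and> G) * ?w)"
        and "\<beta> = (of_bool (\<not> H) :: 'f)"
        and "\<gamma> = (if K then if L then ?w else 1 else - of_bool (2 < card V \<and> L) * ?w)"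
        and "\<delta> = (of_bool (\<not> K) :: 'f)"
      let ?r = "of_bool ((y \<noteq> b) = G) * of_bool ((z \<noteq> b) = L) :: 'f"
      \<comment> \<open>The factors vanish at \<open>u = b\<close>, which leaves
        \<open>card V - 1\<close> points; this count is how \<open>\<kappa>\<close> enters.\<close>
      have "(\<Sum>u\<in>V. coord_entry V b G H I y u * coord_entry V b I K L u z)
        = (\<Sum>u\<in>?W. coord_entry V b G H I y u * (coord_entry V b I K L u z :: 'f))"
        using True V by (intro sum.mono_neutral_right) (auto simp: coord_entry_def)
      also have "\<dots> = (\<Sum>u\<in>?W. ?r * ((\<alpha> + \<beta> * of_bool (y = u)) * (\<gamma> + \<delta> * of_bool (u = z))))"
        using True
        by (intro sum.cong) (auto simp: entry \<alpha>_def \<beta>_def \<gamma>_def \<delta>_def)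
      also have "\<dots> = ?r * (\<alpha> * \<gamma> * \<kappa> + \<alpha> * \<delta> * of_bool (z \<noteq> b)
          + \<beta> * \<gamma> * of_bool (y \<noteq> b) + \<beta> * \<delta> * of_bool (y = z \<and> y \<noteq> b))"
        using V sum_affine_indicators[of ?W \<alpha> \<beta> y \<gamma> \<delta> z] cW
        by (simp flip: sum_distrib_left add: \<kappa>_def)
      finally show ?thesis
        using True HK small \<kappa>1 yz
        by (cases G; cases L; cases H; cases K; cases "2 < card V"; cases "y = z"; cases "\<kappa> = 0")
           (simp_all add: entry \<alpha>_def \<beta>_def \<gamma>_def \<delta>_def)
    qed
  qed
qed

lemma coord_entry_mult_mismatch:
  assumes "I \<noteq> J"
  shows "(\<Sum>u\<in>V. coord_entry V b G H I y u * coord_entry V b J K L u z) = (0::'f::field)"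
  using assms by (intro sum.neutral) (auto simp: coord_entry_def)

lemma coord_entry_nonzero:
  assumes V: "finite V" "2 \<le> card V" "b \<in> V"
    and H: "G \<noteq> I \<Longrightarrow> H" "H \<Longrightarrow> G \<noteq> I \<or> G \<and> I \<and> 2 < card V" "H \<Longrightarrow> of_nat (card V - 1) \<noteq> (0::'f::field)"
  shows "\<exists>y\<in>V. \<exists>z\<in>V. coord_entry V b G H I y z \<noteq> (0::'f)"
proof -
  define \<kappa> where "\<kappa> = (of_nat (card V - 1) :: 'f)"
  note entry = coord_entry_def[where 'f = 'f, of V, folded \<kappa>_def]
  have H': "G \<noteq> I \<longrightarrow> H" "H \<longrightarrow> G \<noteq> I \<or> G \<and> I \<and> 2 < card V" "H \<longrightarrow> \<kappa> \<noteq> 0"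
    using H by (auto simp: \<kappa>_def)
  have "card (V - {b}) \<noteq> 0" using V by simp
  then obtain u where u: "u \<in> V" "u \<noteq> b" by (metis Diff_iff card.empty ex_in_conv insertCI)
  show ?thesis
  \<comment> \<open>For the complement block an off-diagonal entry \<open>- inverse \<kappa>\<close>
    is taken, since the diagonal entry \<open>1 - inverse \<kappa>\<close> may vanish in positive
    characteristic.\<close>
  proof (cases "G \<and> I \<and> \<not> H \<and> 2 < card V \<and> \<kappa> \<noteq> 0")
    case True
    have "card (V - {b, u}) \<noteq> 0" using V u True by simp
    then obtain v where v: "v \<in> V" "v \<noteq> b" "v \<noteq> u" by (metis Diff_iff card.empty ex_in_conv insertCI)
    then have "coord_entry V b G H I u v \<noteq> (0::'f)" using True u by (simp add: entry)
    then show ?thesis using u v by blast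
  next
    case False
    then have "coord_entry V b G H I (if G then u else b) (if I then u else b) \<noteq> (0::'f)"
      using H' u by (auto simp: entry)
    then show ?thesis using u V(3) by (metis (full_types))
  qed
qed

section \<open>Factorisation of the entries of D over the coordinates\<close>

lemma PP_coord:
  assumes "(g, h, i) \<in> PP n U"
  shows "g \<in> EE n" "h \<in> EE n" "i \<in> EE n"
    and "(a \<in> supp n g) \<noteq> (a \<in> supp n i) \<Longrightarrow> a \<in> supp n h"
    and "a \<in> supp n h \<Longrightarrow> (a \<in> supp n g) \<noteq> (a \<in> supp n i) \<or> a \<in> supp n g \<and> a \<in> supp n i \<and> 2 < card (U a)"
  using assms by (auto simp: PP_def circ_def)

text \<open>The double sum groups the admissible \<open>l\<close> by size, and
  \<open>supp n l - supp n h\<close> runs through all subsets of \<open>Q\<close>. The condition on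
  \<open>k\<^sub>l\<close> survives as the restriction of \<open>Q\<close> to coordinates with
  \<open>card (U a) - 1\<close> nonzero in the field.\<close>

lemma DD_sum_over_subsets:
  fixes x :: "nat \<Rightarrow> 'u" and U :: "nat \<Rightarrow> 'u set"
  assumes P: "(g, h, i) \<in> PP n U"
    and h: "\<not> CHAR('f::field) dvd valency n U h"
  defines "Q \<equiv> {a \<in> circ U (supp n g \<inter> supp n i) - supp n h. of_nat (card (U a) - 1) \<noteq> (0::'f)}"
  shows "DD n U x g h i y z = (\<Sum>T\<in>Pow Q. (- 1) ^ card T *
    inverse (of_nat (valency n U (meet n i (with_supp n (supp n h \<union> T)))))
      * (BB n U x g (with_supp n (supp n h \<union> T)) i y z :: 'f))"
proof -
  let ?f = "cprod n U g i"
  let ?L = "{l \<in> EE n. preceq n h l \<and> preceq n l ?f \<and> \<not> CHAR('f) dvd valency n U l}"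
  let ?t = "\<lambda>l. (- 1) ^ card (supp n l - supp n h) * inverse (of_nat (valency n U (meet n i l))) * (BB n U x g l i y z :: 'f)"
  let ?E = "{a \<in> supp n ?f - supp n h. \<not> CHAR('f) dvd (card (U a) - 1)}"
  have sf: "supp n ?f = sym_diff (supp n g) (supp n i) \<union> circ U (supp n g \<inter> supp n i)"
    using supp_subset[of n g] supp_subset[of n i] by (auto simp: cprod_def circ_def)
  \<comment> \<open>The symmetric difference already lies in \<open>supp n h\<close>, so outside it
    only the part under \<open>circ\<close> remains.\<close>
  have QE: "?E = Q"
    using PP_coord(4)[OF P] unfolding sf Q_def of_nat_eq_0_iff_char_dvd by blast
  have good: "\<not> CHAR('f) dvd valency n U l \<longleftrightarrow> supp n l - supp n h \<subseteq> {a. of_nat (card (U a) - 1) \<noteq> (0::'f)}"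
    if "preceq n h l" for l
    using h that unfolding not_CHAR_dvd_valency_iff preceq_def by blast
  have UU: "UU CHAR('f) n U ?f h k = {l \<in> ?L. card (supp n l - supp n h) = k}" for k
    by (auto simp: UU_def)
  have finL: "finite ?L" using finite_EE by simp
  have finE: "finite ?E" by simp
  have "card (supp n l - supp n h) \<le> ndeg CHAR('f) n U ?f h" if "l \<in> ?L" for l
    unfolding ndeg_def
  proof (rule card_mono[OF finE])
    show "supp n l - supp n h \<subseteq> ?E"
      using that good[of l] unfolding preceq_def of_nat_eq_0_iff_char_dvd by blast
  qed
  \<comment> \<open>\<open>ndeg\<close> bounds all the sizes, so the grouping misses no
    \<open>l\<close>.\<close>
  then have rng: "(\<lambda>l. card (supp n l - supp n h)) ` ?L \<subseteq> {0..ndeg CHAR('f) n U ?f h}" by auto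
  have "DD n U x g h i y z = (\<Sum>k = 0..ndeg CHAR('f) n U ?f h. \<Sum>l\<in>{l \<in> ?L. card (supp n l - supp n h) = k}. ?t l)"
    unfolding DD_def UU by (intro sum.cong) auto
  also have "\<dots> = sum ?t ?L"
    by (rule sum.group[OF finL _ rng]) simp
  also have "\<dots> = (\<Sum>T\<in>Pow Q. ?t (with_supp n (supp n h \<union> T)))"
  proof (rule sum.reindex_bij_witness[where i = "\<lambda>T. with_supp n (supp n h \<union> T)" and j = "\<lambda>l. supp n l - supp n h"])
    fix l assume l: "l \<in> ?L"
    then have "supp n h \<union> (supp n l - supp n h) = supp n l" by (auto simp: preceq_def)
    then show eq: "with_supp n (supp n h \<union> (supp n l - supp n h)) = l" using l with_supp_supp by auto
    show "supp n l - supp n h \<in> Pow Q"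
      using l good[of l] unfolding QE[symmetric] preceq_def of_nat_eq_0_iff_char_dvd by blast
    show "?t (with_supp n (supp n h \<union> (supp n l - supp n h))) = ?t l" by (simp only: eq)
  next
    fix T assume T: "T \<in> Pow Q"
    have Qn: "Q \<subseteq> {1..n}" "Q \<inter> supp n h = {}"
      using supp_subset[of n g] by (auto simp: Q_def circ_def)
    then have s: "supp n (with_supp n (supp n h \<union> T)) = supp n h \<union> T"
      using T supp_subset[of n h] unfolding supp_with_supp by blast
    show "supp n (with_supp n (supp n h \<union> T)) - supp n h = T"
      using T Qn unfolding s by blast
    have "preceq n h (with_supp n (supp n h \<union> T))" unfolding preceq_def s by blast
    moreover have "preceq n (with_supp n (supp n h \<union> T)) ?f"
      unfolding preceq_def s sf using T PP_coord(5)[OF P] by (auto simp: Q_def circ_def)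
    moreover have "\<not> CHAR('f) dvd valency n U (with_supp n (supp n h \<union> T))"
      using good[OF calculation(1)] T unfolding s Q_def by blast
    ultimately show "with_supp n (supp n h \<union> T) \<in> ?L" by simp
  qed
  also have "\<dots> = (\<Sum>T\<in>Pow Q. (- 1) ^ card T *
    inverse (of_nat (valency n U (meet n i (with_supp n (supp n h \<union> T)))))
      * (BB n U x g (with_supp n (supp n h \<union> T)) i y z :: 'f))"
  proof (rule sum.cong[OF refl])
    fix T assume T: "T \<in> Pow Q"
    have "supp n (with_supp n (supp n h \<union> T)) - supp n h = T"
      using T supp_subset[of n g] supp_subset[of n h] by (auto simp: Q_def circ_def)
    then show "?t (with_supp n (supp n h \<union> T)) = (- 1) ^ card T *
    inverse (of_nat (valency n U (meet n i (with_supp n (supp n h \<union> T)))))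
      * (BB n U x g (with_supp n (supp n h \<union> T)) i y z :: 'f)" by (simp only:)
  qed
  finally show ?thesis .
qed

text \<open>The coordinates split into \<open>supp n h\<close>, \<open>Q\<close> and the rest. The
  signed sum over subsets \<open>T\<close> is the expansion of the product of
  \<open>- w a + e a\<close> over \<open>Q\<close>, while the other coordinates contribute common
  factors.\<close>

lemma DD_entry:
  fixes x :: "nat \<Rightarrow> 'u" and U :: "nat \<Rightarrow> 'u set"
  assumes fin: "finite (pts n U)" and x: "x \<in> pts n U" and y: "y \<in> pts n U" and z: "z \<in> pts n U"
    and P: "(g, h, i) \<in> PP n U"
    and h: "\<not> CHAR('f::field) dvd valency n U h"
  shows "DD n U x g h i y z = (\<Prod>a\<in>{1..n}. coord_entry (U a) (x a)
    (a \<in> supp n g) (a \<in> supp n h) (a \<in> supp n i) (y a) (z a) :: 'f)"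
proof -
  define w where "w = (\<lambda>a. inverse (of_nat (card (U a) - 1)) :: 'f)"
  define e where "e = (\<lambda>a. of_bool (y a = z a) :: 'f)"
  define Q where "Q = {a \<in> circ U (supp n g \<inter> supp n i) - supp n h. of_nat (card (U a) - 1) \<noteq> (0::'f)}"
  let ?R = "of_bool ((x, y) \<in> rel n U g \<and> (x, z) \<in> rel n U i) :: 'f"
  let ?N = "{1..n}" and ?H = "supp n h" and ?I = "supp n i"
  have Q: "Q \<subseteq> ?N" "Q \<subseteq> ?I" "Q \<inter> ?H = {}" "finite Q"
  proof -
    show "Q \<subseteq> ?N" "Q \<subseteq> ?I" "Q \<inter> ?H = {}"
      using supp_subset[of n g] by (auto simp: Q_def circ_def)
    then show "finite Q" by (meson finite_atLeastAtMost finite_subset)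
  qed
  have H: "?H \<subseteq> ?N" by (rule supp_subset)
  have pe: "prod e S = of_bool (\<forall>a\<in>S. y a = z a)" if "finite S" for S
    using that by (induction S rule: finite_induct) (auto simp: e_def)
  have summand: "(- 1) ^ card T * inverse (of_nat (valency n U (meet n i (with_supp n (?H \<union> T)))))
      * BB n U x g (with_supp n (?H \<union> T)) i y z
    = ?R * prod w (?H \<inter> ?I) * prod e (?N - ?H - Q) * ((\<Prod>a\<in>T. - w a) * prod e (Q - T))"
    if "T \<in> Pow Q" for T
  proof -
    have T: "T \<subseteq> Q" "finite T" using that Q(4) finite_subset by auto
    have s: "supp n (with_supp n (?H \<union> T)) = ?H \<union> T"
      using T Q H unfolding supp_with_supp by blast
    have m: "supp n (meet n i (with_supp n (?H \<union> T))) = (?H \<inter> ?I) \<union> T"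
      using T Q H unfolding meet_def s supp_with_supp by blast
    have "inverse (of_nat (valency n U (meet n i (with_supp n (?H \<union> T))))) = prod w ((?H \<inter> ?I) \<union> T)"
      unfolding valency_def m of_nat_prod w_def by (rule prod_inversef[symmetric, unfolded comp_def])
    also have "\<dots> = prod w (?H \<inter> ?I) * prod w T"
      using T Q by (intro prod.union_disjoint) auto
    finally have v: "inverse (of_nat (valency n U (meet n i (with_supp n (?H \<union> T)))))
      = prod w (?H \<inter> ?I) * prod w T" .
    \<comment> \<open>\<open>BB\<close> tests \<open>y a = z a\<close> outside the middle support;
      the tests outside \<open>Q\<close> do not depend on \<open>T\<close> and can be pulled out of
      the sum.\<close>
    have "{a \<in> ?N. y a \<noteq> z a} \<subseteq> ?H \<union> T \<longleftrightarrow> (\<forall>a\<in>?N - ?H - Q. y a = z a) \<and> (\<forall>a\<in>Q - T. y a = z a)"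
      using T Q H by blast
    then have "BB n U x g (with_supp n (?H \<union> T)) i y z = ?R * (prod e (?N - ?H - Q) * prod e (Q - T))"
      unfolding BB_entry[OF fin y z] s pe[OF finite_Diff[OF Q(4)]] pe[OF finite_Diff[OF finite_Diff[OF finite_atLeastAtMost]]]
      by (simp only: of_bool_conj mult.assoc)
    moreover have "(\<Prod>a\<in>T. - w a) = (- 1) ^ card T * prod w T" by (rule prod_uminus)
    ultimately show ?thesis unfolding v by (simp only: mult_ac)
  qed
  have "DD n U x g h i y z = (\<Sum>T\<in>Pow Q. ?R * prod w (?H \<inter> ?I) * prod e (?N - ?H - Q) * ((\<Prod>a\<in>T. - w a) * prod e (Q - T)))"
    unfolding DD_sum_over_subsets[OF P h] Q_def[symmetric] by (rule sum.cong[OF refl summand])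
  also have "\<dots> = ?R * prod w (?H \<inter> ?I) * prod e (?N - ?H - Q) * (\<Prod>a\<in>Q. - w a + e a)"
    unfolding prod_add[OF Q(4)] by (rule sum_distrib_left[symmetric])
  finally have DD: "DD n U x g h i y z = ?R * prod w (?H \<inter> ?I) * prod e (?N - ?H - Q) * (\<Prod>a\<in>Q. - w a + e a)" .
  let ?c = "\<lambda>a. if a \<in> ?H then if a \<in> ?I then w a else 1
     else e a - of_bool (2 < card (U a) \<and> a \<in> supp n g \<and> a \<in> ?I) * w a"
  have N: "?N = ?H \<union> (Q \<union> (?N - ?H - Q))" using Q H by blast
  have "prod ?c ?N = prod ?c ?H * (prod ?c Q * prod ?c (?N - ?H - Q))"
    using Q by (subst N, subst prod.union_disjoint, simp, simp, blast, subst prod.union_disjoint) auto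
  also have "prod ?c ?H = prod w (?H \<inter> ?I)"
    by (simp add: prod.inter_restrict)
  also have "prod ?c Q = (\<Prod>a\<in>Q. - w a + e a)"
    by (intro prod.cong) (auto simp: Q_def circ_def)
  \<comment> \<open>On the rest the subtracted term is zero: either its indicator is, or
    \<open>card (U a) - 1\<close> vanishes in the field and \<open>w a\<close> is
    \<open>inverse 0 = 0\<close>.\<close>
  also have "prod ?c (?N - ?H - Q) = prod e (?N - ?H - Q)"
    by (intro prod.cong) (auto simp: Q_def circ_def w_def)
  finally have c: "prod ?c ?N = prod w (?H \<inter> ?I) * ((\<Prod>a\<in>Q. - w a + e a) * prod e (?N - ?H - Q))" .
  have "(\<Prod>a\<in>?N. of_bool ((y a \<noteq> x a) = (a \<in> supp n g)) * of_bool ((z a \<noteq> x a) = (a \<in> supp n i))) = ?R"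
  proof -
    have "(\<Prod>a\<in>?N. of_bool ((y a \<noteq> x a) = (a \<in> supp n g)) * of_bool ((z a \<noteq> x a) = (a \<in> supp n i)))
      = (of_bool (\<forall>a\<in>?N. (y a \<noteq> x a) = (a \<in> supp n g) \<and> (z a \<noteq> x a) = (a \<in> supp n i)) :: 'f)"
    proof -
      have "(\<Prod>a\<in>S. of_bool (A a) * of_bool (B a)) = (of_bool (\<forall>a\<in>S. A a \<and> B a) :: 'f)"
        if "finite S" for S :: "nat set" and A B
        using that by (induction S rule: finite_induct) auto
      then show ?thesis by simp
    qed
    also have "(\<forall>a\<in>?N. (y a \<noteq> x a) = (a \<in> supp n g) \<and> (z a \<noteq> x a) = (a \<in> supp n i))
      \<longleftrightarrow> (x, y) \<in> rel n U g \<and> (x, z) \<in> rel n U i"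
    proof -
      have eq: "V = {a \<in> ?N. x a \<noteq> v a} \<longleftrightarrow> (\<forall>a\<in>?N. (v a \<noteq> x a) = (a \<in> V))"
        if "V \<subseteq> ?N" for V v
      proof -
        have "{a \<in> ?N. x a \<noteq> v a} = {a \<in> ?N. v a \<noteq> x a}" by metis
        then show ?thesis using that by blast
      qed
      show ?thesis unfolding rel_iff eq[OF supp_subset] ball_conj_distrib using x y z by simp
    qed
    finally show ?thesis .
  qed
  moreover have "(\<Prod>a\<in>?N. coord_entry (U a) (x a) (a \<in> supp n g) (a \<in> ?H) (a \<in> ?I) (y a) (z a))
    = (\<Prod>a\<in>?N. of_bool ((y a \<noteq> x a) = (a \<in> supp n g)) * of_bool ((z a \<noteq> x a) = (a \<in> supp n i))) * prod ?c ?N"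
    unfolding prod.distrib[symmetric] coord_entry_def w_def e_def by (rule refl)
  ultimately show ?thesis unfolding DD c by (simp only: mult_ac)
qed

section \<open>Products in the Terwilliger algebra\<close>

locale factors =
  fixes n :: nat and U :: "nat \<Rightarrow> 'u set" and x :: "nat \<Rightarrow> 'u"
  assumes factor: "a \<in> {1..n} \<Longrightarrow> finite (U a) \<and> card (U a) \<ge> 2"
    and base: "x \<in> pts n U"
begin

lemma finite_pts: "finite (pts n U)"
  unfolding pts_def using factor by (intro finite_PiE) auto

lemma generators_in_mat_alg:
  "adj n U ` EE n \<union> dual_idem n U x ` EE n
    \<subseteq> carrier (mat_alg (pts n U) :: ('f::field, (nat \<Rightarrow> 'u) \<Rightarrow> (nat \<Rightarrow> 'u) \<Rightarrow> 'f) module)"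
  by (auto simp: mat_alg_simps adj_def dual_idem_def rel_def)

lemma terwilliger_carrier:
  "is_subalgebra (carrier (terwilliger n U x)) (mat_alg (pts n U) :: ('f::field, (nat \<Rightarrow> 'u) \<Rightarrow> (nat \<Rightarrow> 'u) \<Rightarrow> 'f) module)"
  "adj n U ` EE n \<union> dual_idem n U x ` EE n
    \<subseteq> carrier (terwilliger n U x :: ('f::field, (nat \<Rightarrow> 'u) \<Rightarrow> (nat \<Rightarrow> 'u) \<Rightarrow> 'f) module)"
  unfolding terwilliger_def
  by (rule field_algebra.subalgebra_generated[OF field_algebra_mat_alg[OF finite_pts] generators_in_mat_alg])+

lemma terwilliger_eq:
  "terwilliger n U x = (mat_alg (pts n U) :: ('f::field, _) module)\<lparr>carrier := carrier (terwilliger n U x)\<rparr>"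
  by (simp add: terwilliger_def generated_subalgebra_def)

lemma terwilliger_simps:
  "mult (terwilliger n U x) = (mult (mat_alg (pts n U) :: ('f::field, _) module))"
  "zero (terwilliger n U x) = (\<lambda>y z. (0::'f))"
  by (simp_all add: terwilliger_def generated_subalgebra_def mat_alg_simps)

lemma field_algebra_terwilliger: "field_algebra (terwilliger n U x :: ('f::field, _) module)"
  by (subst terwilliger_eq)
    (rule field_algebra.field_algebra_subalgebra[OF field_algebra_mat_alg[OF finite_pts] terwilliger_carrier(1)])

lemma BB_in_terwilliger:
  assumes "g \<in> EE n" "i \<in> EE n"
  shows "BB n U x g h i \<in> carrier (terwilliger n U x :: ('f::field, _) module)"
  unfolding BB_def
proof (rule mat_subalgebra_sum[OF terwilliger_carrier(1)])
  fix j assume "j \<in> {j \<in> EE n. sym_diff (supp n g) (supp n i) \<subseteq> supp n j \<and> supp n j \<subseteq> supp n h}"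
  then have "dual_idem n U x g \<in> carrier (terwilliger n U x :: ('f, _) module)"
    "dual_idem n U x i \<in> carrier (terwilliger n U x :: ('f, _) module)"
    "adj n U j \<in> carrier (terwilliger n U x :: ('f, _) module)"
    using assms terwilliger_carrier(2) by auto
  moreover have "subring (carrier (terwilliger n U x)) (mat_alg (pts n U) :: ('f, _) module)"
    using terwilliger_carrier(1)[where 'f = 'f] by (simp add: is_subalgebra_def)
  ultimately show "dual_idem n U x g \<otimes>\<^bsub>mat_alg (pts n U)\<^esub> adj n U j \<otimes>\<^bsub>mat_alg (pts n U)\<^esub> dual_idem n U x i
    \<in> carrier (terwilliger n U x :: ('f, _) module)"
    by (intro subringE(6))
qed

lemma DD_in_terwilliger:
  assumes "g \<in> EE n" "i \<in> EE n"
  shows "DD n U x g h i \<in> carrier (terwilliger n U x :: ('f::field, _) module)"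
  unfolding DD_def
  by (intro mat_subalgebra_sum[OF terwilliger_carrier(1)] mat_subalgebra_smult[OF terwilliger_carrier(1)]
      BB_in_terwilliger assms)

lemma DD_outside:
  assumes "g \<in> EE n" "i \<in> EE n" "y \<notin> pts n U \<or> z \<notin> pts n U"
  shows "DD n U x g h i y z = (0::'f::field)"
proof -
  have "DD n U x g h i \<in> carrier (mat_alg (pts n U) :: ('f, _) module)"
    using DD_in_terwilliger[OF assms(1,2)] subringE(1) terwilliger_carrier(1)
    unfolding is_subalgebra_def by blast
  then show ?thesis using assms(3) by (auto simp: mat_alg_simps)
qed

section \<open>Products of the D's and the bracket\<close>

lemma supp_bracket:
  "supp n (bracket n U g h i k l) = {a \<in> {1..n}. (a \<in> supp n g) \<noteq> (a \<in> supp n l)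
     \<or> a \<in> supp n g \<and> a \<in> supp n l \<and> 2 < card (U a) \<and> a \<notin> supp n i
     \<or> (a \<in> supp n h \<or> a \<in> supp n k) \<and> a \<in> supp n g \<and> a \<in> supp n i \<and> a \<in> supp n l \<and> 2 < card (U a)}"
  by (auto simp: bracket_def circ_def)

text \<open>A coordinate of the bracket lies in \<open>supp n h\<close> or \<open>supp n k\<close>:
  where \<open>g\<close> and \<open>l\<close> disagree, \<open>i\<close> disagrees with one of them,
  and where both are 1 but \<open>i\<close> is not, \<open>g\<close> and \<open>i\<close> disagree.
  So nonvanishing is inherited factor by factor.\<close>

lemma bracket_in_PP:
  assumes "(g, h, i) \<in> PP n U" "(i, k, l) \<in> PP n U"
    and h: "\<not> CHAR('f::field) dvd valency n U h" and k: "\<not> CHAR('f) dvd valency n U k"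
  shows "(g, bracket n U g h i k l, l) \<in> PP n U"
    and "\<not> CHAR('f) dvd valency n U (bracket n U g h i k l)"
proof -
  show "(g, bracket n U g h i k l, l) \<in> PP n U"
    using assms(1,2) unfolding PP_def mem_Collect_eq case_prod_conv supp_bracket
    by (auto simp: bracket_def circ_def supp_def)
  show "\<not> CHAR('f) dvd valency n U (bracket n U g h i k l)"
    using h k PP_coord(4)[OF assms(1)] PP_coord(4)[OF assms(2)]
    unfolding not_CHAR_dvd_valency_iff supp_bracket by blast
qed

text \<open>The sum over middle points of a product over coordinates is a product of coordinate
  sums, each decided by \<open>coord_entry_mult\<close>. One vanishing coordinate kills the entry,
  so the coordinate conditions combine into an equality of sets.\<close>

lemma DD_mult:
  assumes P: "(g, h, i) \<in> PP n U" "(j, k, l) \<in> PP n U"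
    and h: "\<not> CHAR('f::field) dvd valency n U h" and k: "\<not> CHAR('f) dvd valency n U k"
  shows "DD n U x g h i \<otimes>\<^bsub>terwilliger n U x\<^esub> DD n U x j k l
    = (if i = j \<and> circ U (supp n g \<inter> supp n i) - supp n h = circ U (supp n i \<inter> supp n l) - supp n k
       then DD n U x g (bracket n U g h i k l) l else (\<lambda>y z. (0::'f)))"
proof (intro ext)
  fix y z
  let ?G = "\<lambda>a. a \<in> supp n g" and ?H = "\<lambda>a. a \<in> supp n h" and ?I = "\<lambda>a. a \<in> supp n i"
    and ?J = "\<lambda>a. a \<in> supp n j" and ?K = "\<lambda>a. a \<in> supp n k" and ?L = "\<lambda>a. a \<in> supp n l"
  let ?b = "bracket n U g h i k l"
  let ?s = "\<lambda>a. \<Sum>u\<in>U a. coord_entry (U a) (x a) (?G a) (?H a) (?I a) (y a) u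
      * (coord_entry (U a) (x a) (?J a) (?K a) (?L a) u (z a) :: 'f)"
  note P1 = PP_coord[OF P(1)] and P2 = PP_coord[OF P(2)]
  have l: "(DD n U x g h i \<otimes>\<^bsub>terwilliger n U x\<^esub> DD n U x j k l) y z
      = (\<Sum>v\<in>pts n U. DD n U x g h i y v * (DD n U x j k l v z :: 'f))"
    by (simp add: terwilliger_simps mat_alg_simps)
  show "(DD n U x g h i \<otimes>\<^bsub>terwilliger n U x\<^esub> DD n U x j k l) y z
    = (if i = j \<and> circ U (supp n g \<inter> supp n i) - supp n h = circ U (supp n i \<inter> supp n l) - supp n k
       then DD n U x g ?b l else (\<lambda>y z. (0::'f))) y z"
  proof (cases "y \<in> pts n U \<and> z \<in> pts n U")
    case False
    then have "(\<Sum>v\<in>pts n U. DD n U x g h i y v * (DD n U x j k l v z :: 'f)) = 0"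
      using P1(1,3) P2(1,3) by (intro sum.neutral) (auto simp: DD_outside)
    moreover have "DD n U x g ?b l y z = (0::'f)"
      using False P1(1) P2(3) by (intro DD_outside) auto
    ultimately show ?thesis unfolding l by (auto simp only: split: if_split)
  next
    case True
    have ya: "y a \<in> U a" "z a \<in> U a" "x a \<in> U a" if "a \<in> {1..n}" for a
      using that True base unfolding pts_def by (auto simp: PiE_iff)
    have nH: "of_nat (card (U a) - 1) \<noteq> (0::'f)" if "?H a" for a
      using h that unfolding not_CHAR_dvd_valency_iff by blast
    have nK: "of_nat (card (U a) - 1) \<noteq> (0::'f)" if "?K a" for a
      using k that unfolding not_CHAR_dvd_valency_iff by blast
    have "(\<Sum>v\<in>pts n U. DD n U x g h i y v * (DD n U x j k l v z :: 'f))
      = (\<Sum>v\<in>pts n U. \<Prod>a\<in>{1..n}. coord_entry (U a) (x a) (?G a) (?H a) (?I a) (y a) (v a)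
          * coord_entry (U a) (x a) (?J a) (?K a) (?L a) (v a) (z a))"
      using True
      by (intro sum.cong refl) (simp only: DD_entry[OF finite_pts base _ _ P(1) h]
          DD_entry[OF finite_pts base _ _ P(2) k] prod.distrib)
    also have "\<dots> = (\<Prod>a\<in>{1..n}. ?s a)"
      unfolding pts_def using factor by (intro prod_sum_PiE[symmetric]) auto
    finally have l': "(DD n U x g h i \<otimes>\<^bsub>terwilliger n U x\<^esub> DD n U x j k l) y z = (\<Prod>a\<in>{1..n}. ?s a)"
      unfolding l .
    have coord: "?s a = (if (?G a \<and> ?I a \<and> 2 < card (U a) \<and> \<not> ?H a) = (?I a \<and> ?L a \<and> 2 < card (U a) \<and> \<not> ?K a)
        then coord_entry (U a) (x a) (?G a) (a \<in> supp n ?b) (?L a) (y a) (z a) else 0)"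
      if a: "a \<in> {1..n}" and ij: "i = j" for a
    proof -
      \<comment> \<open>In this form the bracket support is the middle flag produced by
        \<open>coord_entry_mult\<close>.\<close>
      have b: "a \<in> supp n ?b \<longleftrightarrow> ?G a \<noteq> ?L a \<or> ?G a \<and> ?L a \<and> 2 < card (U a) \<and> \<not> ?I a
          \<or> (?H a \<or> ?K a) \<and> ?G a \<and> ?I a \<and> ?L a \<and> 2 < card (U a)"
        using a unfolding supp_bracket by blast
      show ?thesis
        unfolding b ij[symmetric]
        by (rule coord_entry_mult)
          (use a factor[OF a] ya[OF a] nH nK P1(4,5)[of a] P2(4,5)[of a] ij in blast)+
    qed
    show ?thesis
    proof (cases "i = j")
      case False
      then obtain a where a: "a \<in> {1..n}" "?I a \<noteq> ?J a"
        using supp_eq_iff[OF P1(3) P2(1)] supp_subset[of n i] supp_subset[of n j] by blast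
      have "?s a = 0" using a(2) by (rule coord_entry_mult_mismatch)
      then have "(\<Prod>a\<in>{1..n}. ?s a) = 0" using a(1) by (intro prod_zero) blast+
      then show ?thesis unfolding l' using False by simp
    next
      case ij: True
      note P2' = P(2)[folded ij]
      show ?thesis
      proof (cases "circ U (supp n g \<inter> supp n i) - supp n h = circ U (supp n i \<inter> supp n l) - supp n k")
        case eq: True
        have "(?G a \<and> ?I a \<and> 2 < card (U a) \<and> \<not> ?H a) = (?I a \<and> ?L a \<and> 2 < card (U a) \<and> \<not> ?K a)" for a
          using eq unfolding circ_def by blast
        then have "(\<Prod>a\<in>{1..n}. ?s a)
          = (\<Prod>a\<in>{1..n}. coord_entry (U a) (x a) (?G a) (a \<in> supp n ?b) (?L a) (y a) (z a))"
          using coord[OF _ ij] by (intro prod.cong refl) presburger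
        also have "\<dots> = DD n U x g ?b l y z"
          using True by (intro DD_entry[OF finite_pts base _ _ bracket_in_PP[OF P(1) P2' h k], symmetric]) auto
        finally show ?thesis unfolding l' using ij eq by simp
      next
        case neq: False
        then obtain a where "\<not> ((?G a \<and> ?I a \<and> 2 < card (U a) \<and> \<not> ?H a) = (?I a \<and> ?L a \<and> 2 < card (U a) \<and> \<not> ?K a))"
          unfolding circ_def by blast
        moreover from this have a: "a \<in> {1..n}" using supp_subset[of n i] by blast
        ultimately have "?s a = 0" using coord[OF a ij] by (simp only: if_False)
        then have "(\<Prod>a\<in>{1..n}. ?s a) = 0" using a by (intro prod_zero) blast+
        then show ?thesis unfolding l' using neq by simp
      qed
    qed
  qed
qed

text \<open>A pair of points is assembled from one nonzero entry per coordinate.\<close>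

lemma DD_nonzero:
  assumes P: "(g, h, i) \<in> PP n U" and h: "\<not> CHAR('f::field) dvd valency n U h"
  shows "DD n U x g h i \<noteq> (\<lambda>y z. (0::'f))"
proof -
  let ?c = "\<lambda>a. coord_entry (U a) (x a) (a \<in> supp n g) (a \<in> supp n h) (a \<in> supp n i)"
  have "\<exists>v\<in>U a. \<exists>w\<in>U a. ?c a v w \<noteq> (0::'f)" if a: "a \<in> {1..n}" for a
  proof (rule coord_entry_nonzero)
    show "x a \<in> U a" using a base unfolding pts_def by (auto simp: PiE_iff)
    show "of_nat (card (U a) - 1) \<noteq> (0::'f)" if "a \<in> supp n h"
      using h that unfolding not_CHAR_dvd_valency_iff by blast
  qed (use factor[OF a] PP_coord(4,5)[OF P] in blast)+
  then obtain v w where vw: "\<And>a. a \<in> {1..n} \<Longrightarrow> v a \<in> U a \<and> w a \<in> U a \<and> ?c a (v a) (w a) \<noteq> (0::'f)"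
    by metis
  let ?v = "restrict v {1..n}" and ?w = "restrict w {1..n}"
  have "?v \<in> pts n U" "?w \<in> pts n U" using vw by (auto simp: pts_def)
  then have "DD n U x g h i ?v ?w = (\<Prod>a\<in>{1..n}. ?c a (?v a) (?w a) :: 'f)"
    by (rule DD_entry[OF finite_pts base _ _ P h])
  also have "\<dots> \<noteq> 0" using vw by (simp add: prod_zero_iff)
  finally show ?thesis by (auto simp: fun_eq_iff)
qed

section \<open>Transposed triples and the sandwich identity\<close>

lemma PP_swap: "(g, h, i) \<in> PP n U \<Longrightarrow> (i, h, g) \<in> PP n U"
  unfolding PP_def by (simp add: Int_commute Un_commute)

text \<open>The symmetric difference is forced to lie in the middle support; the rest is recovered
  from its complement in \<open>circ U (supp n g \<inter> supp n i)\<close>.\<close>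

lemma PP_eqI:
  assumes "(g, h, i) \<in> PP n U" "(g, b, i) \<in> PP n U"
    and "circ U (supp n g \<inter> supp n i) - supp n h = circ U (supp n g \<inter> supp n i) - supp n b"
  shows "b = h"
proof -
  have "supp n b = supp n h"
    using assms unfolding PP_def by blast
  then show ?thesis
    using assms(1,2) supp_eq_iff[of b n h] PP_coord(2) by blast
qed

text \<open>The triple \<open>(g, h, i)\<close> acts as the matrix unit in row \<open>g\<close> and
  column \<open>i\<close> of the block labelled by
  \<open>circ U (supp n g \<inter> supp n i) - supp n h\<close>, and \<open>(i, h, g)\<close> as its
  transpose. The sandwich is nonzero only if row, column and block of the inner element
  match.\<close>

lemma DD_sandwich:
  assumes P: "(g, h, i) \<in> PP n U" "(a, b, c) \<in> PP n U"
    and h: "\<not> CHAR('f::field) dvd valency n U h" and b: "\<not> CHAR('f) dvd valency n U b"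
  shows "DD n U x i h g \<otimes>\<^bsub>terwilliger n U x\<^esub> DD n U x a b c \<otimes>\<^bsub>terwilliger n U x\<^esub> DD n U x i h g
    = (if (a, b, c) = (g, h, i) then DD n U x i h g else (\<lambda>y z. (0::'f)))"
proof -
  let ?T = "terwilliger n U x :: ('f, _) module"
  let ?m = "bracket n U i h g b c"
  note Ps = PP_swap[OF P(1)]
  have null: "(\<lambda>y z. 0) \<otimes>\<^bsub>?T\<^esub> DD n U x i h g = (\<lambda>y z. 0)"
    by (simp add: terwilliger_simps mat_alg_simps)
  note first = DD_mult[OF Ps P(2) h b]
  show ?thesis
  proof (cases "g = a \<and> circ U (supp n i \<inter> supp n g) - supp n h = circ U (supp n g \<inter> supp n c) - supp n b")
    case False
    then have "(a, b, c) \<noteq> (g, h, i)" by (auto simp: Int_commute)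
    then show ?thesis unfolding first using False null by (simp only: if_False)
  next
    case True
    have P2: "(g, b, c) \<in> PP n U" using P(2) True by simp
    note m = bracket_in_PP[OF Ps P2 h b]
    have eq: "DD n U x i h g \<otimes>\<^bsub>?T\<^esub> DD n U x a b c = DD n U x i ?m c"
      unfolding first by (rule if_P[OF True])
    note second = DD_mult[OF m(1) Ps m(2) h]
    show ?thesis
    proof (cases "c = i")
      case False
      then show ?thesis unfolding eq second by simp
    next
      case ci: True
      have bh: "b = h"
        using True ci P(1) P2 by (intro PP_eqI) (auto simp: Int_commute)
      \<comment> \<open>The first product is the diagonal matrix unit at \<open>i\<close> in this
        block; its middle support is needed to evaluate the second product.\<close>
      have supp_m: "supp n ?m = {a \<in> {1..n}. a \<in> supp n i \<and> 2 < card (U a) \<and> (a \<in> supp n g \<longrightarrow> a \<in> supp n h)}"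
        unfolding supp_bracket bh ci by blast
      have "circ U (supp n i \<inter> supp n c) - supp n ?m = circ U (supp n c \<inter> supp n g) - supp n h"
        unfolding supp_m unfolding ci circ_def using supp_subset[of n i] by blast
      \<comment> \<open>The second bracket returns \<open>h\<close>, so the sandwich reproduces the
        outer element.\<close>
      moreover have "bracket n U i ?m c h g = h"
      proof -
        have "supp n (bracket n U i ?m c h g) = supp n h"
          unfolding supp_bracket[of i ?m c h g] unfolding supp_m unfolding ci
          using PP_coord(4,5)[OF P(1)] supp_subset[of n h] by blast
        then show ?thesis
          using supp_eq_iff[of "bracket n U i ?m c h g" n h] PP_coord(2)[OF P(1)] by (simp add: bracket_def)
      qed
      ultimately show ?thesis
        unfolding eq second using ci bh True by simp
    qed
  qed
qed

end

section \<open>Structure constants modulo the radical\<close>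

theorem theorem7p15:
  fixes n :: nat and U :: "nat \<Rightarrow> 'u set" and x :: "nat \<Rightarrow> 'u"
    and g h i j k l m q r :: "nat \<Rightarrow> nat"
  assumes "n \<ge> 1"
    and "\<And>a. a \<in> {1..n} \<Longrightarrow> finite (U a) \<and> card (U a) \<ge> 2"
    and "x \<in> pts n U"
    and "(g, h, i) \<in> PP n U" and "(j, k, l) \<in> PP n U" and "(m, q, r) \<in> PP n U"
    and "\<not> CHAR('f::field) dvd valency n U h * valency n U k * valency n U q"
  shows "(i = j \<and> circ U (supp n h \<inter> supp n i \<inter> supp n l) \<subseteq> supp n k \<longrightarrow>
            (g, bracket n U g h i k l, l) \<in> PP n U \<and>
            \<not> CHAR('f) dvd valency n U (bracket n U g h i k l)) \<and>
         basis_coeff (TRad n U x) (Dbasis n U x)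
            (Dcoset n U x g h i \<otimes>\<^bsub>TRad n U x\<^esub> Dcoset n U x j k l) (Dcoset n U x m q r) =
           (of_bool (i = j) * of_bool (m = g) * of_bool (q = bracket n U g h i k l) *
            of_bool (r = l) *
            of_bool (circ U (supp n g \<inter> supp n i) - supp n h =
                     circ U (supp n i \<inter> supp n l) - supp n k) :: 'f)"
proof -
  interpret F: factors n U x
    by (rule factors.intro[OF assms(2,3)])
  let ?T = "terwilliger n U x :: ('f, _) module"
  interpret T: field_algebra ?T by (rule F.field_algebra_terwilliger)
  have hkq: "\<not> CHAR('f) dvd valency n U h" "\<not> CHAR('f) dvd valency n U k" "\<not> CHAR('f) dvd valency n U q"
    using assms(7) by (auto intro: dvd_mult dvd_mult2)
  let ?b = "bracket n U g h i k l"
  let ?cond = "i = j \<and> circ U (supp n g \<inter> supp n i) - supp n h = circ U (supp n i \<inter> supp n l) - supp n k"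
  have br: "(g, ?b, l) \<in> PP n U" "\<not> CHAR('f) dvd valency n U ?b" if "i = j"
    using F.bracket_in_PP[OF assms(4) _ hkq(1,2)] assms(5) that by blast+
  define S where "S = {(a, b, c) \<in> PP n U. \<not> CHAR('f) dvd valency n U b}"
  define D where "D = (\<lambda>(a, b, c). DD n U x a b c :: (nat \<Rightarrow> 'u) \<Rightarrow> (nat \<Rightarrow> 'u) \<Rightarrow> 'f)"
  \<comment> \<open>Reversing a triple transposes the matrix unit; this supplies the sandwiching
    elements.\<close>
  define \<tau> :: "(nat \<Rightarrow> nat) \<times> (nat \<Rightarrow> nat) \<times> (nat \<Rightarrow> nat) \<Rightarrow> (nat \<Rightarrow> nat) \<times> (nat \<Rightarrow> nat) \<times> (nat \<Rightarrow> nat)"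
    where "\<tau> = (\<lambda>(a, b, c). (c, b, a))"
  define J where "J = jacobson_radical ?T"
  have J: "ideal J ?T" unfolding J_def by (rule T.jacobson_radical_ideal)
  have finS: "finite S"
    by (rule finite_subset[OF _ finite_PP]) (auto simp: S_def)
  have DS: "D \<in> S \<rightarrow> carrier ?T"
  proof
    fix s assume s: "s \<in> S"
    obtain a b c where abc: "s = (a, b, c)" by (cases s)
    have "(a, b, c) \<in> PP n U" using s by (simp add: S_def abc)
    from PP_coord(1,3)[OF this] show "D s \<in> carrier ?T"
      unfolding abc D_def case_prod_conv by (rule F.DD_in_terwilliger)
  qed
  have \<tau>S: "\<tau> \<in> S \<rightarrow> S"
  proof
    fix s assume s: "s \<in> S"
    obtain a b c where abc: "s = (a, b, c)" by (cases s)
    show "\<tau> s \<in> S" using s F.PP_swap[of a b c] by (simp add: S_def \<tau>_def abc)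
  qed
  have unit: "D (\<tau> t) \<otimes>\<^bsub>?T\<^esub> D s \<otimes>\<^bsub>?T\<^esub> D (\<tau> t) = (if s = t then D (\<tau> t) else \<zero>\<^bsub>?T\<^esub>)"
    if "s \<in> S" "t \<in> S" for s t
  proof -
    obtain a b c where s: "s = (a, b, c)" by (cases s)
    obtain a' b' c' where t: "t = (a', b', c')" by (cases t)
    have "(a, b, c) \<in> PP n U" "\<not> CHAR('f) dvd valency n U b"
      "(a', b', c') \<in> PP n U" "\<not> CHAR('f) dvd valency n U b'"
      using that by (auto simp: S_def s t)
    then show ?thesis
      unfolding s t D_def \<tau>_def case_prod_conv F.terwilliger_simps(2)
      by (intro F.DD_sandwich)
  qed
  have nz: "D t \<noteq> \<zero>\<^bsub>?T\<^esub>" if "t \<in> S" for t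
  proof -
    obtain a b c where t: "t = (a, b, c)" by (cases t)
    then show ?thesis
      using that F.DD_nonzero[of a b c, where 'f = 'f]
      unfolding D_def F.terwilliger_simps(2) by (simp add: S_def)
  qed
  have basis: "Dbasis n U x = (\<lambda>s. J +>\<^bsub>?T\<^esub> D s) ` S"
  proof -
    have "Dbasis n U x = {J +>\<^bsub>?T\<^esub> DD n U x a b c | a b c. (a, b, c) \<in> PP n U \<and> \<not> CHAR('f) dvd valency n U b}"
      unfolding Dbasis_def Dcoset_def J_def ..
    also have "\<dots> = (\<lambda>s. J +>\<^bsub>?T\<^esub> D s) ` S"
      unfolding image_def S_def D_def by (simp only: split_paired_Ex mem_Collect_eq Bex_def case_prod_conv) blast
    finally show ?thesis .
  qed
  \<comment> \<open>The product is a single basis element or zero. The indicator includes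
    \<open>?cond\<close> because the coefficient must vanish with the product, even if the bracket
    triple happens to be an index.\<close>
  define c :: "_ \<Rightarrow> 'f" where "c = (\<lambda>s. of_bool (?cond \<and> s = (g, ?b, l)))"
  have Dgl: "D s \<in> carrier ?T" if "s \<in> S" for s using DS that by blast
  have expand: "DD n U x g h i \<otimes>\<^bsub>?T\<^esub> DD n U x j k l = (\<Oplus>\<^bsub>?T\<^esub>s\<in>S. c s \<odot>\<^bsub>?T\<^esub> D s)"
  proof (cases ?cond)
    case True
    have S: "(g, ?b, l) \<in> S" using br True by (simp add: S_def)
    have "(\<Oplus>\<^bsub>?T\<^esub>s\<in>S. c s \<odot>\<^bsub>?T\<^esub> D s) = (\<Oplus>\<^bsub>?T\<^esub>s\<in>S. if (g, ?b, l) = s then D s else \<zero>\<^bsub>?T\<^esub>)"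
      using Dgl True by (intro T.finsum_cong') (auto simp: c_def)
    also have "\<dots> = D (g, ?b, l)" using S finS DS by (rule T.add.finprod_singleton)
    also have "\<dots> = DD n U x g ?b l" by (simp add: D_def)
    finally show ?thesis
      unfolding F.DD_mult[OF assms(4,5) hkq(1,2)] if_P[OF True] by (rule sym)
  next
    case False
    then have "(\<Oplus>\<^bsub>?T\<^esub>s\<in>S. c s \<odot>\<^bsub>?T\<^esub> D s) = (\<Oplus>\<^bsub>?T\<^esub>s\<in>S. \<zero>\<^bsub>?T\<^esub>)"
      using Dgl by (intro T.finsum_cong') (auto simp: c_def)
    also have "\<dots> = \<zero>\<^bsub>?T\<^esub>" by (rule T.finsum_zero)
    finally show ?thesis
      unfolding F.DD_mult[OF assms(4,5) hkq(1,2)] if_not_P[OF False] F.terwilliger_simps(2) by (rule sym)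
  qed
  have prod: "Dcoset n U x g h i \<otimes>\<^bsub>TRad n U x\<^esub> Dcoset n U x j k l
      = J +>\<^bsub>?T\<^esub> (\<Oplus>\<^bsub>?T\<^esub>s\<in>S. c s \<odot>\<^bsub>?T\<^esub> D s)"
    unfolding Dcoset_def TRad_def J_def[symmetric] expand[symmetric]
    using F.DD_in_terwilliger PP_coord(1,3)[OF assms(4)] PP_coord(1,3)[OF assms(5)]
    by (intro T.quot_alg_mult[OF J]) auto
  have mqr: "(m, q, r) \<in> S" using assms(6) hkq(3) by (simp add: S_def)
  have "basis_coeff (TRad n U x) (Dbasis n U x)
      (Dcoset n U x g h i \<otimes>\<^bsub>TRad n U x\<^esub> Dcoset n U x j k l) (Dcoset n U x m q r)
    = basis_coeff (quot_alg ?T J) ((\<lambda>s. J +>\<^bsub>?T\<^esub> D s) ` S)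
        (J +>\<^bsub>?T\<^esub> (\<Oplus>\<^bsub>?T\<^esub>s\<in>S. c s \<odot>\<^bsub>?T\<^esub> D s)) (J +>\<^bsub>?T\<^esub> D (m, q, r))"
    unfolding prod basis by (simp add: TRad_def Dcoset_def D_def J_def)
  also have "\<dots> = c (m, q, r)"
    unfolding J_def by (rule T.matrix_units_basis_coeff[OF finS DS \<tau>S unit nz mqr])
  also have "\<dots> = of_bool (i = j) * of_bool (m = g) * of_bool (q = ?b) * of_bool (r = l) *
      of_bool (circ U (supp n g \<inter> supp n i) - supp n h = circ U (supp n i \<inter> supp n l) - supp n k)"
    unfolding c_def prod.inject of_bool_conj by (simp only: mult_ac)
  finally show ?thesis using br by blast
qed

end
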